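(* Let $X,Y,Z$ be metric spaces, let $x_0\in X$ be a fixed base point, let $C\in[0,\infty)$, and let $p\colon Y\to Z$ be a $C$-dense bornologous map with the coarse path lifting property. Assume that $Y$ is uniformly discrete and that $Z$ has $C$-bounded geometry. If $X$, $Y$ and $Z$ are each coarsely embeddable into a Hilbert space, then the metric wreath product $X\wr_Z^C Y$ (formed with respect to $p$ and $x_0$) is coarsely embeddable into a Hilbert space.
   Context: Write $\mathbb{R}^+=[0,\infty)$ and $B(x,r)=\{x' : d(x,x')\le r\}$. **Coarse embeddability.** A metric space $(X,d)$ is coarsely embeddable into a Hilbert space if there are a Hilbert space $\mathcal H$, a map $f\colon X\to\mathcal H$ and non-decreasing functions $\rho_-,\rho_+\colon\mathbb{R}^+\to\mathbb{R}^+$ with $\lim_{t\to\infty}\rho_{\pm}(t)=+\infty$ such that $\rho_-(d(x,x'))\le\|f(x)-f(x')\|\le\rho_+(d(x,x'))$ for all $x,x'\in X$. **Conditions on spaces and maps.** - A metric space $X$ is uniformly discrete if there is $\delta>0$ such that $B(x,\delta)=\{x\}$ for all $x\in X$. - A metric space $X$ has $C$-bounded geometry if there is a constant $N(C)>0$ such that $|B(x,C)|\le N(C)$ for all $x\in X$. - A map $p\colon Y\to Z$ is $C$-dense if every $z\in Z$ satisfies $d_Z(p(y),z)\le C$ for some $y\in Y$. - A map $p\colon Y\to Z$ is bornologous if for every $R>0$ there is $S_R>0$ such that $d_Y(y,y')\le R$ implies $d_Z(p(y),p(y'))\le S_R$ for all $y,y'\in Y$. - A $C$-dense map $p\colon Y\to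 Z$ has the coarse path lifting property if there is a non-decreasing function $\theta\colon\mathbb{R}^+\to\mathbb{R}^+$ such that for all $z,z'\in Z$ and $y\in Y$ with $d_Y$-point $y$ satisfying $d_Z(p(y),z)\le C$ there is $y'\in Y$ with $d_Z(p(y'),z')\le C$ and $d_Y(y,y')\le\theta(d_Z(z,z'))$. **Metric wreath product.** Let $p\colon Y\to Z$ be $C$-dense and $x_0\in X$. - For a finite set $I=\{z_1,\dots,z_n\}\subset Z$ of $n$ distinct points, let $\mathcal P_I$ be the set of $(y_1,\dots,y_n)\in Y^n$ for which there is a permutation $\sigma\in S_n$ with $p(y_i)\in B(z_{\sigma(i)},C)$ for all $i$. - For $y,y'\in Y$ define $$\mathrm{path}_I(y,y')=\inf_{(y_1,\dots,y_n)\in\mathcal P_I}\Big(d_Y(y,y_1)+\sum_{i=1}^{n-1}d_Y(y_i,y_{i+1})+d_Y(y_n,y')\Big),$$ with $\mathrm{path}_\emptyset(y,y')=d_Y(y,y')$. - Let $\bigoplus_Z X$ be the set of functions $\mathbf f\colon Z\to X$ with $\mathbf f(z)=x_0$ for all but finitely many $z\in Z$. For $\mathbf f,\mathbf g\in\bigoplus_Z X$ let $\mathrm{Supp}(\mathbf f^{-1}\mathbf g)=\{z\in Z:\mathbf f(z)\ne\mathbf g(z)\}$, a finite set. - $X\wr_Z^C Y$ is the set $\bigoplus_Z X\times Y$ with the metric $$d((\mathbf f,y),(\mathbf g,y'))=\mathrm{path}_I(y,y')+\sum_{z\in Z}d_X(\mathbf f(z),\mathbf g(z)),\qquad I=\mathrm{Supp}(\mathbf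 f^{-1}\mathbf g).$$ *)

theory Defs
  imports "HOL-Analysis.Analysis"
begin

section \<open>Hilbert spaces\<close>

definition ip_dist ::
  "('v \<Rightarrow> 'v \<Rightarrow> 'v) \<Rightarrow> (real \<Rightarrow> 'v \<Rightarrow> 'v) \<Rightarrow> ('v \<Rightarrow> 'v \<Rightarrow> real) \<Rightarrow> 'v \<Rightarrow> 'v \<Rightarrow> real" where
  "ip_dist add smul ip u v =
     sqrt (ip (add u (smul (- 1) v)) (add u (smul (- 1) v)))"

text \<open>Real Hilbert spaces with an explicit carrier, so that the existence of such a space can be
  asserted inside a formula. A complex Hilbert space is a real one with the real part of its
  inner product, and this does not change the norm.\<close>

locale hilbert_space =
  fixes V :: "'v set" and add :: "'v \<Rightarrow> 'v \<Rightarrow> 'v" and zero :: 'v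
    and smul :: "real \<Rightarrow> 'v \<Rightarrow> 'v" and ip :: "'v \<Rightarrow> 'v \<Rightarrow> real"
  assumes add_closed: "\<lbrakk>u \<in> V; v \<in> V\<rbrakk> \<Longrightarrow> add u v \<in> V"
    and zero_closed: "zero \<in> V"
    and smul_closed: "u \<in> V \<Longrightarrow> smul a u \<in> V"
    and add_assoc: "\<lbrakk>u \<in> V; v \<in> V; w \<in> V\<rbrakk> \<Longrightarrow> add (add u v) w = add u (add v w)"
    and add_commute: "\<lbrakk>u \<in> V; v \<in> V\<rbrakk> \<Longrightarrow> add u v = add v u"
    and add_zero: "u \<in> V \<Longrightarrow> add u zero = u"
    and add_neg: "u \<in> V \<Longrightarrow> add u (smul (- 1) u) = zero"
    and smul_one: "u \<in> V \<Longrightarrow> smul 1 u = u"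
    and smul_smul: "u \<in> V \<Longrightarrow> smul a (smul b u) = smul (a * b) u"
    and smul_add_right: "\<lbrakk>u \<in> V; v \<in> V\<rbrakk> \<Longrightarrow> smul a (add u v) = add (smul a u) (smul a v)"
    and smul_add_left: "u \<in> V \<Longrightarrow> smul (a + b) u = add (smul a u) (smul b u)"
    and ip_commute: "\<lbrakk>u \<in> V; v \<in> V\<rbrakk> \<Longrightarrow> ip u v = ip v u"
    and ip_add: "\<lbrakk>u \<in> V; v \<in> V; w \<in> V\<rbrakk> \<Longrightarrow> ip (add u v) w = ip u w + ip v w"
    and ip_smul: "\<lbrakk>u \<in> V; v \<in> V\<rbrakk> \<Longrightarrow> ip (smul a u) v = a * ip u v"
    and ip_nonneg: "u \<in> V \<Longrightarrow> 0 \<le> ip u u"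
    and ip_definite: "\<lbrakk>u \<in> V; ip u u = 0\<rbrakk> \<Longrightarrow> u = zero"
    and complete: "\<lbrakk>\<And>n. s n \<in> V;
          \<And>e. e > 0 \<Longrightarrow> \<exists>N. \<forall>m\<ge>N. \<forall>n\<ge>N. ip_dist add smul ip (s m) (s n) < e\<rbrakk>
        \<Longrightarrow> \<exists>l\<in>V. (\<lambda>n. ip_dist add smul ip (s n) l) \<longlonglongrightarrow> 0"

lemma hilbert_space_UNIV:
  "hilbert_space (UNIV :: 'h::{real_inner,complete_space} set) (+) 0 (*\<^sub>R) (\<bullet>)"
proof -
  have dist: "ip_dist (+) (*\<^sub>R) (\<bullet>) u v = dist u v" for u v :: 'h
    by (simp add: ip_dist_def dist_norm norm_eq_sqrt_inner)
  show ?thesis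
  proof (unfold_locales, goal_cases)
    case (17 s)
    then have "Cauchy s"
      unfolding dist by (intro metric_CauchyI) auto
    then obtain l where "s \<longlonglongrightarrow> l"
      using Cauchy_convergent convergent_def by blast
    then show ?case
      unfolding dist using tendsto_dist_iff by blast
  qed (auto simp: algebra_simps inner_commute inner_add_left inner_add_right)
qed

context hilbert_space
begin

lemma ip_add_right: "\<lbrakk>u \<in> V; v \<in> V; w \<in> V\<rbrakk> \<Longrightarrow> ip w (add u v) = ip w u + ip w v"
  by (metis add_closed ip_add ip_commute)

lemma ip_smul_right: "\<lbrakk>u \<in> V; v \<in> V\<rbrakk> \<Longrightarrow> ip v (smul a u) = a * ip v u"
  by (metis ip_commute ip_smul smul_closed)

lemma ip_zero: "u \<in> V \<Longrightarrow> ip zero u = 0"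
  using ip_add[of zero zero u] add_zero zero_closed by simp

lemma ip_Cauchy_Schwarz:
  assumes "u \<in> V" "v \<in> V"
  shows "(ip u v)\<^sup>2 \<le> ip u u * ip v v"
proof (cases "ip v v = 0")
  case True
  then show ?thesis using assms ip_definite ip_zero ip_commute zero_closed by force
next
  case False
  then have pos: "ip v v > 0" using assms ip_nonneg[of v] by simp
  define c where "c = ip u v / ip v v"
  let ?w = "add u (smul (- c) v)"
  have "0 \<le> ip ?w ?w" using assms by (intro ip_nonneg add_closed smul_closed)
  also have "ip ?w ?w = ip u u - 2 * c * ip u v + c * c * ip v v"
    using assms ip_commute[of v u]
    by (simp add: ip_add ip_add_right ip_smul ip_smul_right add_closed smul_closed algebra_simps)
  also have "\<dots> = ip u u - (ip u v)\<^sup>2 / ip v v"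
    using pos by (simp add: c_def field_simps power2_eq_square)
  finally show ?thesis using pos by (simp add: field_simps)
qed

lemma hilbert_subspace:
  assumes sub: "W \<subseteq> V" and z: "zero \<in> W"
    and a: "\<And>u v. \<lbrakk>u \<in> W; v \<in> W\<rbrakk> \<Longrightarrow> add u v \<in> W"
    and s: "\<And>c u. u \<in> W \<Longrightarrow> smul c u \<in> W"
    and closed: "\<And>s l. \<lbrakk>\<And>n. s n \<in> W; l \<in> V; (\<lambda>n. ip_dist add smul ip (s n) l) \<longlonglongrightarrow> 0\<rbrakk> \<Longrightarrow> l \<in> W"
  shows "hilbert_space W add zero smul ip"
proof (unfold_locales, goal_cases)
  case (17 s)
  then show ?case using closed sub complete[of s] by blast
next
  case 5
  then show ?case using add_commute sub by blast
next
  case 12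
  then show ?case using ip_commute sub by blast
qed (use sub z a s in \<open>auto simp: add_assoc add_zero add_neg smul_one smul_smul
      smul_add_right smul_add_left ip_add ip_smul ip_nonneg ip_definite subset_iff\<close>)

lemma hilbert_transport:
  assumes bij: "bij_betw F V V'"
    and G: "\<And>v. v \<in> V \<Longrightarrow> G (F v) = v"
  shows "hilbert_space V' (\<lambda>a b. F (add (G a) (G b))) (F zero)
           (\<lambda>c a. F (smul c (G a))) (\<lambda>a b. ip (G a) (G b))"
    (is "hilbert_space V' ?add ?zero ?smul ?ip")
proof -
  have FV: "F v \<in> V'" if "v \<in> V" for v using bij that by (auto simp: bij_betw_def)
  have GV: "G a \<in> V" if "a \<in> V'" for a using bij that G by (auto simp: bij_betw_def)
  have FG: "F (G a) = a" if "a \<in> V'" for a using bij that G by (auto simp: bij_betw_def)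
  have dist: "ip_dist ?add ?smul ?ip a b = ip_dist add smul ip (G a) (G b)"
    if "a \<in> V'" "b \<in> V'" for a b
    using that by (simp add: ip_dist_def G GV add_closed smul_closed)
  show ?thesis
  proof (unfold_locales, goal_cases)
    case (17 s)
    have "\<exists>l\<in>V. (\<lambda>n. ip_dist add smul ip (G (s n)) l) \<longlonglongrightarrow> 0"
      using 17 dist GV by (intro complete) auto
    then obtain l where l: "l \<in> V" "(\<lambda>n. ip_dist add smul ip (G (s n)) l) \<longlonglongrightarrow> 0" by blast
    show ?case
      using l 17 by (intro bexI[of _ "F l"]) (auto simp: dist FV G)
  next
    case (16 u)
    then show ?case using ip_definite[of "G u"] FG GV by metis
  next
    case 5
    then show ?case using add_commute GV by metis
  next
    case 12
    then show ?case using ip_commute GV by metis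
  qed (auto simp: FV GV FG G add_closed zero_closed smul_closed add_assoc add_zero
      add_neg smul_one smul_smul smul_add_right smul_add_left ip_add ip_smul
      ip_nonneg)
qed

end

section \<open>Coarse embeddability\<close>

definition coarse_embedding ::
  "'a metric \<Rightarrow> 'v set \<Rightarrow> ('v \<Rightarrow> 'v \<Rightarrow> real) \<Rightarrow> ('a \<Rightarrow> 'v) \<Rightarrow> bool" where
  "coarse_embedding X V \<delta> f \<longleftrightarrow>
     f \<in> mspace X \<rightarrow> V \<and>
     (\<exists>\<rho>\<^sub>1 \<rho>\<^sub>2 :: real \<Rightarrow> real.
        \<rho>\<^sub>1 \<in> {0..} \<rightarrow> {0..} \<and> mono_on {0..} \<rho>\<^sub>1 \<and> filterlim \<rho>\<^sub>1 at_top at_top \<and>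
        \<rho>\<^sub>2 \<in> {0..} \<rightarrow> {0..} \<and> mono_on {0..} \<rho>\<^sub>2 \<and> filterlim \<rho>\<^sub>2 at_top at_top \<and>
        (\<forall>x\<in>mspace X. \<forall>x'\<in>mspace X.
           \<rho>\<^sub>1 (mdist X x x') \<le> \<delta> (f x) (f x') \<and> \<delta> (f x) (f x') \<le> \<rho>\<^sub>2 (mdist X x x')))"

text \<open>A formula cannot quantify over types, so the elements of the Hilbert space are taken from
  the type \<open>'a \<Rightarrow> real\<close>. This is no restriction: by \<open>hilbert_coarsely_embeddableI\<close> below, a coarse
  embedding into a Hilbert space with elements in any type suffices.\<close>

definition hilbert_coarsely_embeddable :: "'a metric \<Rightarrow> bool" where
  "hilbert_coarsely_embeddable X \<longleftrightarrow>
     (\<exists>(V :: ('a \<Rightarrow> real) set) add zero smul ip f.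
        hilbert_space V add zero smul ip \<and> coarse_embedding X V (ip_dist add smul ip) f)"

theorem hilbert_coarsely_embeddableI:
  fixes X :: "'a metric" and V :: "'v set"
  assumes H: "hilbert_space V add zero smul ip"
    and f: "coarse_embedding X V (ip_dist add smul ip) f"
  shows "hilbert_coarsely_embeddable X"
proof -
  interpret hilbert_space V add zero smul ip by (rule H)
  let ?M = "mspace X"
  have fV: "f x \<in> V" if "x \<in> ?M" for x using f that by (auto simp: coarse_embedding_def)
  \<comment> \<open>the closed span of the image of \<open>f\<close>, as a double orthogonal complement\<close>
  define W where "W = {v \<in> V. \<forall>u\<in>V. (\<forall>x\<in>?M. ip u (f x) = 0) \<longrightarrow> ip v u = 0}"
  have WV: "W \<subseteq> V" by (auto simp: W_def)
  have fW: "f x \<in> W" if "x \<in> ?M" for x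
    using that fV by (auto simp: W_def ip_commute)
  have closed: "l \<in> W" if s: "\<And>n. s n \<in> W" and l: "l \<in> V"
    and lim: "(\<lambda>n. ip_dist add smul ip (s n) l) \<longlonglongrightarrow> 0" for s l
  proof -
    have "ip l u = 0" if u: "u \<in> V" "\<forall>x\<in>?M. ip u (f x) = 0" for u
    proof -
      have "\<bar>ip l u\<bar> \<le> ip_dist add smul ip (s n) l * sqrt (ip u u)" for n
      proof -
        have sn: "s n \<in> V" "ip (s n) u = 0" using s[of n] u by (auto simp: W_def)
        let ?w = "add (s n) (smul (- 1) l)"
        have w: "?w \<in> V" using sn l by (simp add: add_closed smul_closed)
        have "ip ?w u = - ip l u"
          using sn l u by (simp add: ip_add ip_smul smul_closed)
        then have "(ip l u)\<^sup>2 \<le> ip ?w ?w * ip u u"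
          using ip_Cauchy_Schwarz[OF w u(1)] by simp
        then have "sqrt ((ip l u)\<^sup>2) \<le> sqrt (ip ?w ?w * ip u u)" by (rule real_sqrt_le_mono)
        then show ?thesis by (simp add: ip_dist_def real_sqrt_mult)
      qed
      moreover have "(\<lambda>n. ip_dist add smul ip (s n) l * sqrt (ip u u)) \<longlonglongrightarrow> 0 * sqrt (ip u u)"
        using lim by (intro tendsto_intros)
      ultimately have "\<bar>ip l u\<bar> \<le> 0 * sqrt (ip u u)"
        by (intro LIMSEQ_le_const) auto
      then show ?thesis by simp
    qed
    then show ?thesis using l by (auto simp: W_def)
  qed
  have HW: "hilbert_space W add zero smul ip"
  proof (rule hilbert_subspace[OF WV])
    show "zero \<in> W" by (simp add: W_def zero_closed ip_zero)
    show "add u v \<in> W" if "u \<in> W" "v \<in> W" for u v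
      using that by (simp add: W_def add_closed ip_add)
    show "smul c u \<in> W" if "u \<in> W" for c u
      using that by (simp add: W_def smul_closed ip_smul)
  qed (rule closed)
  define F where "F = (\<lambda>v x. if x \<in> ?M then ip v (f x) else 0)"
  have inj: "inj_on F W"
  proof (rule inj_onI)
    fix u v assume uv: "u \<in> W" "v \<in> W" "F u = F v"
    let ?w = "add u (smul (- 1) v)"
    have V: "u \<in> V" "v \<in> V" using uv WV by auto
    then have w: "?w \<in> V" by (simp add: add_closed smul_closed)
    have "ip ?w (f x) = 0" if "x \<in> ?M" for x
      using fun_cong[OF uv(3), of x] that V fV by (simp add: F_def ip_add ip_smul smul_closed)
    then have "ip u ?w = 0" "ip v ?w = 0" using uv w by (auto simp: W_def)
    then have "ip ?w ?w = 0" using V w by (simp add: ip_add ip_smul smul_closed)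
    then have 0: "?w = zero" using w ip_definite by blast
    have "u = add u (add (smul (- 1) v) v)"
      using V add_neg[of v] add_commute[of v "smul (- 1) v"] by (simp add: add_zero smul_closed)
    also have "\<dots> = add ?w v" using V by (simp add: add_assoc smul_closed)
    also have "\<dots> = v" using 0 V add_commute zero_closed add_zero by metis
    finally show "u = v" .
  qed
  define G where "G = inv_into W F"
  have G: "G (F v) = v" if "v \<in> W" for v using that inj by (simp add: G_def)
  let ?add = "\<lambda>a b. F (add (G a) (G b))" and ?smul = "\<lambda>c a. F (smul c (G a))"
    and ?ip = "\<lambda>a b. ip (G a) (G b)"
  have H': "hilbert_space (F ` W) ?add (F zero) ?smul ?ip"
    using hilbert_space.hilbert_transport[OF HW, of F "F ` W" G] inj G by (simp add: bij_betw_def)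
  have "ip_dist ?add ?smul ?ip (F (f x)) (F (f x')) = ip_dist add smul ip (f x) (f x')"
    if "x \<in> ?M" "x' \<in> ?M" for x x'
    using that
    by (simp add: ip_dist_def G fW hilbert_space.add_closed[OF HW] hilbert_space.smul_closed[OF HW])
  then have "coarse_embedding X (F ` W) (ip_dist ?add ?smul ?ip) (\<lambda>x. F (f x))"
    using f fW unfolding coarse_embedding_def by (simp add: Pi_iff)
  then show ?thesis
    using H' unfolding hilbert_coarsely_embeddable_def by blast
qed

corollary hilbert_coarsely_embeddableI_class:
  fixes f :: "'a \<Rightarrow> 'h::{real_inner,complete_space}"
  assumes "coarse_embedding X UNIV dist f"
  shows "hilbert_coarsely_embeddable X"
proof -
  have "ip_dist (+) (*\<^sub>R) (\<bullet>) = (dist :: 'h \<Rightarrow> 'h \<Rightarrow> real)"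
    by (simp add: fun_eq_iff ip_dist_def dist_norm norm_eq_sqrt_inner)
  then show ?thesis
    using hilbert_coarsely_embeddableI[OF hilbert_space_UNIV] assms by metis
qed

section \<open>Conditions on spaces and maps\<close>

definition uniformly_discrete :: "'a metric \<Rightarrow> bool" where
  "uniformly_discrete X \<longleftrightarrow> (\<exists>\<delta>>0. \<forall>x\<in>mspace X. mcball_of X x \<delta> = {x})"

definition bounded_geometry :: "real \<Rightarrow> 'a metric \<Rightarrow> bool" where
  "bounded_geometry C X \<longleftrightarrow>
     (\<exists>N::nat. N > 0 \<and> (\<forall>x\<in>mspace X. finite (mcball_of X x C) \<and> card (mcball_of X x C) \<le> N))"

definition dense_map :: "real \<Rightarrow> 'y metric \<Rightarrow> 'z metric \<Rightarrow> ('y \<Rightarrow> 'z) \<Rightarrow> bool" where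
  "dense_map C Y Z p \<longleftrightarrow>
     p \<in> mspace Y \<rightarrow> mspace Z \<and> (\<forall>z\<in>mspace Z. \<exists>y\<in>mspace Y. mdist Z (p y) z \<le> C)"

definition bornologous :: "'y metric \<Rightarrow> 'z metric \<Rightarrow> ('y \<Rightarrow> 'z) \<Rightarrow> bool" where
  "bornologous Y Z p \<longleftrightarrow>
     p \<in> mspace Y \<rightarrow> mspace Z \<and>
     (\<forall>R>0. \<exists>S>0. \<forall>y\<in>mspace Y. \<forall>y'\<in>mspace Y. mdist Y y y' \<le> R \<longrightarrow> mdist Z (p y) (p y') \<le> S)"

definition coarse_path_lifting :: "real \<Rightarrow> 'y metric \<Rightarrow> 'z metric \<Rightarrow> ('y \<Rightarrow> 'z) \<Rightarrow> bool" where
  "coarse_path_lifting C Y Z p \<longleftrightarrow>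
     (\<exists>\<theta> :: real \<Rightarrow> real. \<theta> \<in> {0..} \<rightarrow> {0..} \<and> mono_on {0..} \<theta> \<and>
        (\<forall>z\<in>mspace Z. \<forall>z'\<in>mspace Z. \<forall>y\<in>mspace Y. mdist Z (p y) z \<le> C \<longrightarrow>
           (\<exists>y'\<in>mspace Y. mdist Z (p y') z' \<le> C \<and> mdist Y y y' \<le> \<theta> (mdist Z z z'))))"

section \<open>The metric wreath product\<close>

text \<open>A permutation of a fixed enumeration of \<open>I\<close> is an arbitrary enumeration \<open>zs\<close> of \<open>I\<close>.\<close>

definition visiting_tuples ::
  "real \<Rightarrow> ('y \<Rightarrow> 'z) \<Rightarrow> 'y metric \<Rightarrow> 'z metric \<Rightarrow> 'z set \<Rightarrow> 'y list set" where
  "visiting_tuples C p Y Z I =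
     {ys. set ys \<subseteq> mspace Y \<and>
          (\<exists>zs. distinct zs \<and> set zs = I \<and> list_all2 (\<lambda>y z. p y \<in> mcball_of Z z C) ys zs)}"

primrec path_length :: "'y metric \<Rightarrow> 'y \<Rightarrow> 'y list \<Rightarrow> 'y \<Rightarrow> real" where
  "path_length Y y [] y' = mdist Y y y'"
| "path_length Y y (w # ws) y' = mdist Y y w + path_length Y w ws y'"

definition visiting_path ::
  "real \<Rightarrow> ('y \<Rightarrow> 'z) \<Rightarrow> 'y metric \<Rightarrow> 'z metric \<Rightarrow> 'z set \<Rightarrow> 'y \<Rightarrow> 'y \<Rightarrow> real" where
  "visiting_path C p Y Z I y y' = (INF ys\<in>visiting_tuples C p Y Z I. path_length Y y ys y')"

definition supp_diff :: "'z metric \<Rightarrow> ('z \<Rightarrow> 'x) \<Rightarrow> ('z \<Rightarrow> 'x) \<Rightarrow> 'z set" where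
  "supp_diff Z f g = {z \<in> mspace Z. f z \<noteq> g z}"

definition wreath_space ::
  "'x \<Rightarrow> 'x metric \<Rightarrow> 'y metric \<Rightarrow> 'z metric \<Rightarrow> (('z \<Rightarrow> 'x) \<times> 'y) set" where
  "wreath_space x0 X Y Z =
     {f \<in> mspace Z \<rightarrow>\<^sub>E mspace X. finite {z \<in> mspace Z. f z \<noteq> x0}} \<times> mspace Y"

text \<open>The sum runs over the finite support, since \<open>sum\<close> over an infinite set is \<open>0\<close>.\<close>

definition wreath_dist ::
  "real \<Rightarrow> ('y \<Rightarrow> 'z) \<Rightarrow> 'x metric \<Rightarrow> 'y metric \<Rightarrow> 'z metric
     \<Rightarrow> ('z \<Rightarrow> 'x) \<times> 'y \<Rightarrow> ('z \<Rightarrow> 'x) \<times> 'y \<Rightarrow> real" where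
  "wreath_dist C p X Y Z = (\<lambda>(f, y) (g, y').
     visiting_path C p Y Z (supp_diff Z f g) y y' +
     (\<Sum>z\<in>supp_diff Z f g. mdist X (f z) (g z)))"

text \<open>The type \<open>metric\<close> of the library requires the distance to be symmetric and nonnegative
  outside the carrier as well, hence the value \<open>0\<close> there. That this is a metric on the carrier
  is \<open>mspace_metric_wreath\<close> and \<open>mdist_metric_wreath\<close> below.\<close>

definition metric_wreath ::
  "real \<Rightarrow> ('y \<Rightarrow> 'z) \<Rightarrow> 'x \<Rightarrow> 'x metric \<Rightarrow> 'y metric \<Rightarrow> 'z metric
     \<Rightarrow> (('z \<Rightarrow> 'x) \<times> 'y) metric" where
  "metric_wreath C p x0 X Y Z =
     metric (wreath_space x0 X Y Z,
             \<lambda>a b. if a \<in> wreath_space x0 X Y Z \<and> b \<in> wreath_space x0 X Y Z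
                   then wreath_dist C p X Y Z a b else 0)"

lemma path_length_nonneg: "0 \<le> path_length Y y ws y'"
  by (induction ws arbitrary: y) auto

lemma path_length_append:
  "path_length Y y (us @ w # vs) y' = path_length Y y us w + path_length Y w vs y'"
  by (induction us arbitrary: y) auto

lemma path_length_rev: "path_length Y y' (rev ws) y = path_length Y y ws y'"
  by (induction ws arbitrary: y) (auto simp: path_length_append mdist_commute)

lemma path_length_start:
  assumes "y \<in> mspace Y" "w \<in> mspace Y" "set ws \<subseteq> mspace Y" "y' \<in> mspace Y"
  shows "path_length Y y ws y' \<le> mdist Y y w + path_length Y w ws y'"
  using assms mdist_triangle[of _ Y] by (cases ws) (auto simp: add.assoc[symmetric])

lemma path_length_concat:
  assumes "y \<in> mspace Y" "y' \<in> mspace Y" "y'' \<in> mspace Y" "set us \<subseteq> mspace Y" "set vs \<subseteq> mspace Y"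
  shows "path_length Y y (us @ vs) y'' \<le> path_length Y y us y' + path_length Y y' vs y''"
  using assms by (induction us arbitrary: y) (auto intro: path_length_start)

lemma path_length_prune:
  assumes "list_all2 R us zs" "K \<subseteq> set zs" "y \<in> mspace Y" "y' \<in> mspace Y" "set us \<subseteq> mspace Y"
  shows "\<exists>ws ws'. list_all2 R ws ws' \<and> distinct ws' \<and> set ws' = K \<and> set ws \<subseteq> set us \<and>
           path_length Y y ws y' \<le> path_length Y y us y'"
  using assms
proof (induction arbitrary: K y rule: list_all2_induct)
  case Nil
  then show ?case by auto
next
  case (Cons u us z zs)
  have "K - {z} \<subseteq> set zs" using Cons by auto
  moreover have "u \<in> mspace Y" "set us \<subseteq> mspace Y" using Cons.prems by auto
  ultimately obtain ws ws' where ws: "list_all2 R ws ws'" "distinct ws'" "set ws' = K - {z}"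
      "set ws \<subseteq> set us" "path_length Y u ws y' \<le> path_length Y u us y'"
    using Cons.IH[of "K - {z}" u] Cons.prems(3) by blast
  show ?case
  proof (cases "z \<in> K")
    case True
    then show ?thesis
      using ws Cons.hyps by (intro exI[of _ "u # ws"] exI[of _ "z # ws'"]) auto
  next
    case False
    have "path_length Y y ws y' \<le> mdist Y y u + path_length Y u ws y'"
      using Cons.prems ws by (intro path_length_start) auto
    then show ?thesis
      using ws False by (intro exI[of _ ws] exI[of _ ws']) auto
  qed
qed

lemma visiting_path_le:
  "ys \<in> visiting_tuples C p Y Z I \<Longrightarrow> visiting_path C p Y Z I y y' \<le> path_length Y y ys y'"
  unfolding visiting_path_def
  by (intro cINF_lower bdd_belowI2[of _ 0]) (auto simp: path_length_nonneg)

lemma visiting_tuples_nonempty: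
  assumes p: "dense_map C Y Z p" and I: "finite I" "I \<subseteq> mspace Z"
  shows "visiting_tuples C p Y Z I \<noteq> {}"
proof -
  obtain zs where zs: "set zs = I" "distinct zs" using I finite_distinct_list by blast
  have "\<exists>y\<in>mspace Y. p y \<in> mcball_of Z z C" if "z \<in> I" for z
  proof -
    have z: "z \<in> mspace Z" using that I by auto
    then obtain y where "y \<in> mspace Y" "mdist Z (p y) z \<le> C"
      using p by (auto simp: dense_map_def)
    moreover from this have "p y \<in> mspace Z" using p by (auto simp: dense_map_def)
    ultimately show ?thesis using z mdist_commute[of Z z "p y"] by auto
  qed
  then obtain q where "\<forall>z\<in>I. q z \<in> mspace Y \<and> p (q z) \<in> mcball_of Z z C"
    by metis
  then have "map q zs \<in> visiting_tuples C p Y Z I"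
    using zs unfolding visiting_tuples_def
    by (auto intro!: exI[of _ zs] simp: list_all2_map1 list_all2_same simp del: in_mcball_of)
  then show ?thesis by blast
qed

lemma visiting_path_nonneg:
  assumes "dense_map C Y Z p" "finite I" "I \<subseteq> mspace Z"
  shows "0 \<le> visiting_path C p Y Z I y y'"
  unfolding visiting_path_def
  by (intro cINF_greatest visiting_tuples_nonempty assms path_length_nonneg)

lemma visiting_path_empty: "visiting_path C p Y Z {} y y' = mdist Y y y'"
proof -
  have "visiting_tuples C p Y Z {} = {[]}" by (auto simp: visiting_tuples_def)
  then show ?thesis by (simp add: visiting_path_def)
qed

lemma visiting_path_commute: "visiting_path C p Y Z I y y' = visiting_path C p Y Z I y' y"
proof -
  have rev: "rev ys \<in> visiting_tuples C p Y Z I" if "ys \<in> visiting_tuples C p Y Z I" for ys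
  proof -
    from that obtain zs where "distinct zs" "set zs = I" "set ys \<subseteq> mspace Y"
        "list_all2 (\<lambda>y z. p y \<in> mcball_of Z z C) ys zs"
      by (auto simp: visiting_tuples_def)
    then show ?thesis
      unfolding visiting_tuples_def
      by (auto intro!: exI[of _ "rev zs"] simp: list_all2_rev simp del: in_mcball_of)
  qed
  then have "rev ` visiting_tuples C p Y Z I = visiting_tuples C p Y Z I"
    by (force simp: image_iff intro: bexI[of _ "rev _"])
  then have "visiting_path C p Y Z I y y'
      = (INF ys\<in>rev ` visiting_tuples C p Y Z I. path_length Y y ys y')"
    by (simp add: visiting_path_def)
  also have "\<dots> = visiting_path C p Y Z I y' y"
    by (simp add: visiting_path_def image_image path_length_rev)
  finally show ?thesis .
qed

lemma visiting_path_triangle: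
  assumes p: "dense_map C Y Z p" and I: "finite I" "I \<subseteq> mspace Z" and J: "finite J" "J \<subseteq> mspace Z"
    and K: "K \<subseteq> I \<union> J" and y: "y \<in> mspace Y" "y' \<in> mspace Y" "y'' \<in> mspace Y"
  shows "visiting_path C p Y Z K y y'' \<le> visiting_path C p Y Z I y y' + visiting_path C p Y Z J y' y''"
proof -
  let ?T = "visiting_tuples C p Y Z" and ?P = "visiting_path C p Y Z"
  have *: "?P K y y'' \<le> path_length Y y us y' + path_length Y y' vs y''"
    if "us \<in> ?T I" "vs \<in> ?T J" for us vs
  proof -
    let ?R = "\<lambda>y z. p y \<in> mcball_of Z z C"
    from that obtain zs zs' where zs: "set zs = I" "list_all2 ?R us zs" "set zs' = J"
        "list_all2 ?R vs zs'" and Y: "set us \<subseteq> mspace Y" "set vs \<subseteq> mspace Y"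
      unfolding visiting_tuples_def by blast
    have "list_all2 ?R (us @ vs) (zs @ zs')" using zs by (intro list_all2_appendI)
    from path_length_prune[OF this, of K y Y y''] obtain ws ws'
      where ws: "list_all2 ?R ws ws'" "distinct ws'" "set ws' = K" "set ws \<subseteq> set (us @ vs)"
        "path_length Y y ws y'' \<le> path_length Y y (us @ vs) y''"
      using K zs Y y by (auto simp del: in_mcball_of)
    have "ws \<in> ?T K" using ws Y unfolding visiting_tuples_def by auto
    then have "?P K y y'' \<le> path_length Y y ws y''" by (rule visiting_path_le)
    also have "\<dots> \<le> path_length Y y us y' + path_length Y y' vs y''"
      using ws(5) path_length_concat[OF y Y] by simp
    finally show ?thesis .
  qed
  have "?P K y y'' - path_length Y y us y' \<le> ?P J y' y''" if "us \<in> ?T I" for us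
    unfolding visiting_path_def[of C p Y Z J]
    using *[OF that] by (intro cINF_greatest visiting_tuples_nonempty p J) (simp add: algebra_simps)
  then have "?P K y y'' - ?P J y' y'' \<le> ?P I y y'"
    unfolding visiting_path_def[of C p Y Z I]
    by (intro cINF_greatest visiting_tuples_nonempty p I) (simp add: algebra_simps)
  then show ?thesis by simp
qed

lemma finite_supp_diff:
  assumes "(f, y) \<in> wreath_space x0 X Y Z" "(g, y') \<in> wreath_space x0 X Y Z"
  shows "finite (supp_diff Z f g)"
proof -
  have "supp_diff Z f g \<subseteq> {z \<in> mspace Z. f z \<noteq> x0} \<union> {z \<in> mspace Z. g z \<noteq> x0}"
    by (auto simp: supp_diff_def)
  then show ?thesis
    using assms by (auto simp: wreath_space_def intro: finite_subset)
qed

lemma Metric_space_wreath: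
  fixes X :: "'x metric" and Y :: "'y metric" and Z :: "'z metric"
  assumes p: "dense_map C Y Z p"
  shows "Metric_space (wreath_space x0 X Y Z)
           (\<lambda>a b. if a \<in> wreath_space x0 X Y Z \<and> b \<in> wreath_space x0 X Y Z
                  then wreath_dist C p X Y Z a b else 0)"
proof -
  let ?W = "wreath_space x0 X Y Z" and ?d = "wreath_dist C p X Y Z" and ?S = "supp_diff Z :: ('z \<Rightarrow> 'x) \<Rightarrow> _"
  have S: "?S f g \<subseteq> mspace Z" for f g by (auto simp: supp_diff_def)
  have S_commute: "?S f g = ?S g f" for f g by (auto simp: supp_diff_def)
  have d: "?d (f, y) (g, y') = visiting_path C p Y Z (?S f g) y y' +
      (\<Sum>z\<in>?S f g. mdist X (f z) (g z))" for f g y y'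
    by (simp add: wreath_dist_def)
  have nonneg: "0 \<le> ?d a b" if "a \<in> ?W" "b \<in> ?W" for a b
    using that finite_supp_diff[of _ _ x0 X Y Z] visiting_path_nonneg[OF p _ S]
    by (cases a; cases b) (auto simp: d intro!: add_nonneg_nonneg sum_nonneg)
  have commute: "?d a b = ?d b a" for a b
    by (cases a; cases b)
      (auto simp: d S_commute visiting_path_commute mdist_commute)
  have zero: "?d a b = 0 \<longleftrightarrow> a = b" if W: "a \<in> ?W" "b \<in> ?W" for a b
  proof -
    obtain f y g y' where ab: "a = (f, y)" "b = (g, y')" by (cases a; cases b)
    have fin: "finite (?S f g)" using W finite_supp_diff[of f y x0 X Y Z g y'] ab by simp
    have y: "y \<in> mspace Y" "y' \<in> mspace Y" using W ab by (auto simp: wreath_space_def)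
    show ?thesis
    proof
      assume "?d a b = 0"
      moreover have s: "0 \<le> (\<Sum>z\<in>?S f g. mdist X (f z) (g z))" by (intro sum_nonneg) auto
      moreover have "0 \<le> visiting_path C p Y Z (?S f g) y y'"
        by (intro visiting_path_nonneg p fin S)
      ultimately have eq: "visiting_path C p Y Z (?S f g) y y' = 0"
          "(\<Sum>z\<in>?S f g. mdist X (f z) (g z)) = 0"
        by (auto simp: ab d)
      have "mdist X (f z) (g z) = 0" if "z \<in> ?S f g" for z
        using eq(2) fin that by (subst (asm) sum_nonneg_eq_0_iff) auto
      moreover have "mdist X (f z) (g z) \<noteq> 0" if "z \<in> ?S f g" for z
      proof -
        have "f z \<in> mspace X" "g z \<in> mspace X"
          using W that ab by (auto simp: wreath_space_def supp_diff_def)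
        then show ?thesis using that by (simp add: supp_diff_def)
      qed
      ultimately have emp: "?S f g = {}" by blast
      then have "f z = g z" if "z \<in> mspace Z" for z using that by (auto simp: supp_diff_def)
      then have "f = g"
        using W ab by (intro PiE_ext[of f "mspace Z" "\<lambda>_. mspace X" g]) (auto simp: wreath_space_def)
      moreover have "y = y'" using eq(1) y by (simp add: emp visiting_path_empty)
      ultimately show "a = b" by (simp add: ab)
    next
      assume "a = b"
      then have "f = g" "y = y'" by (auto simp: ab)
      moreover have "?S g g = {}" by (auto simp: supp_diff_def)
      ultimately show "?d a b = 0" using y by (simp add: ab d visiting_path_empty)
    qed
  qed
  have tri: "?d a c \<le> ?d a b + ?d b c" if W: "a \<in> ?W" "b \<in> ?W" "c \<in> ?W" for a b c
  proof -
    obtain f y g y' h y'' where abc: "a = (f, y)" "b = (g, y')" "c = (h, y'')"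
      by (cases a; cases b; cases c)
    let ?A = "?S f g \<union> ?S g h"
    have fin: "finite (?S f g)" "finite (?S g h)" "finite (?S f h)"
      using W finite_supp_diff[of f y x0 X Y Z g y'] finite_supp_diff[of g y' x0 X Y Z h y'']
        finite_supp_diff[of f y x0 X Y Z h y''] abc by simp_all
    have Xm: "f z \<in> mspace X" "g z \<in> mspace X" "h z \<in> mspace X" if "z \<in> mspace Z" for z
      using W that abc by (auto simp: wreath_space_def)
    have y: "y \<in> mspace Y" "y' \<in> mspace Y" "y'' \<in> mspace Y"
      using W abc by (auto simp: wreath_space_def)
    have sub: "?S f h \<subseteq> ?A" by (auto simp: supp_diff_def)
    have ext: "(\<Sum>z\<in>?S u v. mdist X (u z) (v z)) = (\<Sum>z\<in>?A. mdist X (u z) (v z))"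
      if "?S u v \<subseteq> ?A" "\<And>z. z \<in> mspace Z \<Longrightarrow> v z \<in> mspace X" for u v
      using that fin S by (intro sum.mono_neutral_left) (auto simp: supp_diff_def)
    have "(\<Sum>z\<in>?A. mdist X (f z) (h z)) \<le> (\<Sum>z\<in>?A. mdist X (f z) (g z) + mdist X (g z) (h z))"
      using S by (intro sum_mono mdist_triangle Xm) auto
    then have "(\<Sum>z\<in>?S f h. mdist X (f z) (h z))
        \<le> (\<Sum>z\<in>?S f g. mdist X (f z) (g z)) + (\<Sum>z\<in>?S g h. mdist X (g z) (h z))"
      using ext[of f h] ext[of f g] ext[of g h] sub Xm by (simp add: sum.distrib)
    moreover have "visiting_path C p Y Z (?S f h) y y''
        \<le> visiting_path C p Y Z (?S f g) y y' + visiting_path C p Y Z (?S g h) y' y''"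
      by (intro visiting_path_triangle p fin S sub y)
    ultimately show ?thesis by (simp add: abc d)
  qed
  show ?thesis
    by unfold_locales (use nonneg commute zero tri in auto)
qed

theorem mspace_metric_wreath:
  "dense_map C Y Z p \<Longrightarrow> mspace (metric_wreath C p x0 X Y Z) = wreath_space x0 X Y Z"
  unfolding metric_wreath_def by (rule Metric_space.mspace_metric[OF Metric_space_wreath])

theorem mdist_metric_wreath:
  "\<lbrakk>dense_map C Y Z p; a \<in> wreath_space x0 X Y Z; b \<in> wreath_space x0 X Y Z\<rbrakk>
     \<Longrightarrow> mdist (metric_wreath C p x0 X Y Z) a b = wreath_dist C p X Y Z a b"
  unfolding metric_wreath_def by (simp add: Metric_space.mdist_metric[OF Metric_space_wreath])

end

theory Submission
  imports Defs
begin

text \<open>A space embeds coarsely into a Hilbert space if and only if it carries a kernel \<open>N\<close>, given by the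
  squared distances of an \<open>\<ell>\<^sup>2\<close>-valued map, such that \<open>N\<close> and the metric bound each other
  (\<open>hilbert_coarsely_embeddable_coordinates\<close>, \<open>hilbert_coarsely_embeddable_kernelI\<close>). Let \<open>I\<close> be the set
  where the lamp configurations of \<open>(f, y)\<close> and \<open>(g, y')\<close> differ. A bound on the wreath distance is
  equivalent to a bound on the following quantities together: the distance of \<open>y\<close> and \<open>y'\<close>, the
  cardinality of \<open>I\<close>, the distances of \<open>f z\<close> and \<open>g z\<close> for \<open>z \<in> I\<close>, and the distances of \<open>p y\<close> and the
  points of \<open>I\<close>. In one direction, a short path meets few points since \<open>Y\<close> is uniformly discrete, each of
  them serves few points of \<open>Z\<close> by bounded geometry, and \<open>p\<close> is bornologous (\<open>visited_set_bounds\<close>); in the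
  other, path lifting reaches each point of \<open>I\<close> from \<open>y\<close> (\<open>visiting_path_star\<close>).

  The first quantity is controlled by the kernel of \<open>Y\<close>, the second and the third by the sum over \<open>I\<close> of the
  kernel of \<open>X\<close> plus the discrete kernel. The last one needs an idea, because a sum over all lamps of
  kernels that depend on \<open>y\<close> would diverge. Suppose that the geometry of \<open>Z\<close> is described by weighted cuts
  \<open>A\<close>, that is, subsets such that the total weight \<open>D y z\<close> of the cuts that contain \<open>y\<close> and omit \<open>z\<close> is
  coarsely equivalent to the distance. For each cut that contains \<open>p y\<close>, let \<open>(f, y)\<close> record the restriction
  of \<open>f\<close> to the complement of the cut. Two such records differ only on cuts that separate \<open>p y\<close> from \<open>p y'\<close>
  or from a point of \<open>I\<close>, so the resulting kernel is finite, and it dominates \<open>D (p y) z\<close> for every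
  \<open>z \<in> I\<close> (\<open>lamp_kernel\<close>). This is the lifting of measured walls to wreath products of Cornulier, Stalder
  and Valette.

  It remains to obtain cuts from an embedding of \<open>Z\<close> into a Hilbert space (\<open>coarse_cut_kernel\<close>). Gaussian
  kernels turn the embedding into maps to the unit sphere that are almost constant at one scale and almost
  orthogonal at a larger one. Squaring coordinates turns unit vectors of \<open>\<ell>\<^sup>2\<close> into probability vectors of
  \<open>\<ell>\<^sup>1\<close>, and an \<open>\<ell>\<^sup>1\<close> distance is an integral over cuts, the superlevel sets of the coordinates
  (\<open>threshold_cuts\<close>). Summing over all scales gives the required cuts.\<close>

section \<open>Coordinates in a Hilbert space\<close>

context hilbert_space
begin

definition orthonormal :: "'v set \<Rightarrow> bool" where
  "orthonormal E \<longleftrightarrow> E \<subseteq> V \<and> (\<forall>e\<in>E. \<forall>e'\<in>E. ip e e' = (if e = e' then 1 else 0))"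

text \<open>The component of \<open>v\<close> orthogonal to the listed vectors, if these are orthonormal. Recursion
  over a list avoids finite sums in \<open>V\<close>, whose addition is not that of a type class.\<close>

primrec residual :: "'v \<Rightarrow> 'v list \<Rightarrow> 'v" where
  "residual v [] = v"
| "residual v (e # es) = add (residual v es) (smul (- ip v e) e)"

lemma residual_closed: "\<lbrakk>v \<in> V; set es \<subseteq> V\<rbrakk> \<Longrightarrow> residual v es \<in> V"
  by (induction es) (auto simp: add_closed smul_closed)

lemma ip_residual:
  assumes "v \<in> V" "set es \<subseteq> V" "distinct es" "u \<in> V"
  shows "ip (residual v es) u = ip v u - (\<Sum>e\<in>set es. ip v e * ip e u)"
  using assms by (induction es) (auto simp: ip_add ip_smul residual_closed smul_closed)

lemma ip_residual_basis:
  assumes E: "orthonormal E" and es: "set es \<subseteq> E" "distinct es" and v: "v \<in> V" and e: "e \<in> E"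
  shows "ip (residual v es) e = (if e \<in> set es then 0 else ip v e)"
proof -
  have EV: "E \<subseteq> V" using E by (simp add: orthonormal_def)
  have "(\<Sum>d\<in>set es. ip v d * ip d e) = (\<Sum>d\<in>set es. if d = e then ip v d else 0)"
    using E es e by (intro sum.cong) (auto simp: orthonormal_def)
  then show ?thesis
    using EV es e v by (subst ip_residual) auto
qed

lemma ip_residual_residual:
  assumes E: "orthonormal E" and es: "set es \<subseteq> E" "distinct es" and fs: "set fs \<subseteq> E" "distinct fs"
    and v: "v \<in> V"
  shows "ip (residual v es) (residual v fs) = ip v v - (\<Sum>e\<in>set es \<union> set fs. (ip v e)\<^sup>2)"
proof -
  have EV: "E \<subseteq> V" using E by (simp add: orthonormal_def)
  have V: "set es \<subseteq> V" "set fs \<subseteq> V" using EV es fs by auto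
  have r: "residual v fs \<in> V" using V v by (simp add: residual_closed)
  have 1: "ip v (residual v fs) = ip v v - (\<Sum>e\<in>set fs. (ip v e)\<^sup>2)"
  proof -
    have "ip v (residual v fs) = ip (residual v fs) v" using r v by (rule ip_commute[rotated])
    also have "\<dots> = ip v v - (\<Sum>e\<in>set fs. ip v e * ip e v)"
      using V fs v by (intro ip_residual) auto
    also have "(\<Sum>e\<in>set fs. ip v e * ip e v) = (\<Sum>e\<in>set fs. (ip v e)\<^sup>2)"
      using V v ip_commute by (intro sum.cong) (auto simp: power2_eq_square subset_iff)
    finally show ?thesis .
  qed
  have 2: "(\<Sum>e\<in>set es. ip v e * ip e (residual v fs)) = (\<Sum>e\<in>set es - set fs. (ip v e)\<^sup>2)"
  proof -
    have "ip e (residual v fs) = (if e \<in> set fs then 0 else ip v e)" if "e \<in> set es" for e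
      using ip_residual_basis[OF E fs v, of e] ip_commute[OF _ r, of e] that es V
      by (auto simp: subset_iff)
    then have "(\<Sum>e\<in>set es. ip v e * ip e (residual v fs))
        = (\<Sum>e\<in>set es. if e \<in> set fs then 0 else (ip v e)\<^sup>2)"
      by (intro sum.cong) (auto simp: power2_eq_square)
    also have "\<dots> = (\<Sum>e\<in>set es - set fs. (ip v e)\<^sup>2)"
      by (intro sum.mono_neutral_cong_right) auto
    finally show ?thesis .
  qed
  have "(\<Sum>e\<in>set es \<union> set fs. (ip v e)\<^sup>2)
      = (\<Sum>e\<in>set fs. (ip v e)\<^sup>2) + (\<Sum>e\<in>set es - set fs. (ip v e)\<^sup>2)"
    by (subst sum.union_disjoint[symmetric]) (auto intro: sum.cong)
  then show ?thesis
    using ip_residual[OF v V(1) es(2) r] 1 2 by simp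
qed

lemma ip_dist_square:
  assumes "u \<in> V" "v \<in> V"
  shows "(ip_dist add smul ip u v)\<^sup>2 = ip u u + ip v v - 2 * ip u v"
proof -
  have "0 \<le> ip (add u (smul (- 1) v)) (add u (smul (- 1) v))"
    using assms by (intro ip_nonneg add_closed smul_closed)
  then show ?thesis
    using assms ip_commute[of v u]
    by (simp add: ip_dist_def add_closed smul_closed ip_add ip_add_right ip_smul ip_smul_right)
qed

lemma tendsto_ip:
  assumes "\<And>n. s n \<in> V" "l \<in> V" "(\<lambda>n. ip_dist add smul ip (s n) l) \<longlonglongrightarrow> 0" "u \<in> V"
  shows "(\<lambda>n. ip (s n) u) \<longlonglongrightarrow> ip l u"
proof -
  have "\<bar>ip (s n) u - ip l u\<bar> \<le> ip_dist add smul ip (s n) l * sqrt (ip u u)" for n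
  proof -
    let ?w = "add (s n) (smul (- 1) l)"
    have "(ip ?w u)\<^sup>2 \<le> ip ?w ?w * ip u u"
      using assms by (intro ip_Cauchy_Schwarz add_closed smul_closed)
    then have "sqrt ((ip ?w u)\<^sup>2) \<le> sqrt (ip ?w ?w * ip u u)" by (rule real_sqrt_le_mono)
    then show ?thesis
      using assms by (simp add: ip_dist_def real_sqrt_mult ip_add ip_smul smul_closed)
  qed
  moreover have "(\<lambda>n. ip_dist add smul ip (s n) l * sqrt (ip u u)) \<longlonglongrightarrow> 0 * sqrt (ip u u)"
    using assms by (intro tendsto_intros)
  ultimately have "(\<lambda>n. ip (s n) u - ip l u) \<longlonglongrightarrow> 0"
    using Lim_null_comparison[of "\<lambda>n. ip (s n) u - ip l u"
        "\<lambda>n. ip_dist add smul ip (s n) l * sqrt (ip u u)" sequentially]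
    by simp
  then show ?thesis using LIM_zero_iff by blast
qed

text \<open>Zorn's lemma yields a maximal orthonormal set, and a nonzero vector orthogonal to it could be
  normalized and added.\<close>

lemma exists_total_orthonormal:
  obtains E where "orthonormal E" "\<And>v. \<lbrakk>v \<in> V; \<forall>e\<in>E. ip v e = 0\<rbrakk> \<Longrightarrow> v = zero"
proof -
  have "\<exists>M\<in>{E. orthonormal E}. \<forall>X\<in>{E. orthonormal E}. M \<subseteq> X \<longrightarrow> X = M"
  proof (rule subset_Zorn')
    fix \<C> assume C: "subset.chain {E. orthonormal E} \<C>"
    have "ip e e' = (if e = e' then 1 else 0)" if e: "e \<in> \<Union>\<C>" "e' \<in> \<Union>\<C>" for e e'
    proof -
      from e obtain A B where "A \<in> \<C>" "e \<in> A" "B \<in> \<C>" "e' \<in> B" by blast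
      moreover have "A \<subseteq> B \<or> B \<subseteq> A" using C \<open>A \<in> \<C>\<close> \<open>B \<in> \<C>\<close> by (auto simp: subset.chain_def)
      ultimately obtain D where "D \<in> \<C>" "e \<in> D" "e' \<in> D" by blast
      moreover have "orthonormal D" using C \<open>D \<in> \<C>\<close> by (auto simp: subset.chain_def)
      ultimately show ?thesis by (simp add: orthonormal_def)
    qed
    moreover have "\<Union>\<C> \<subseteq> V"
      using C by (auto simp: subset.chain_def orthonormal_def)
    ultimately show "\<Union>\<C> \<in> {E. orthonormal E}" by (simp add: orthonormal_def)
  qed
  then obtain E where E: "orthonormal E" and max: "\<And>E'. \<lbrakk>orthonormal E'; E \<subseteq> E'\<rbrakk> \<Longrightarrow> E' = E"
    by auto
  have "v = zero" if v: "v \<in> V" and perp: "\<forall>e\<in>E. ip v e = 0" for v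
  proof (rule ccontr)
    assume "v \<noteq> zero"
    then have pos: "ip v v > 0" using v ip_definite[of v] ip_nonneg[of v] by fastforce
    define w where "w = smul (1 / sqrt (ip v v)) v"
    have w: "w \<in> V" using v by (simp add: w_def smul_closed)
    have "ip w w = 1" using v pos by (simp add: w_def ip_smul ip_smul_right smul_closed)
    moreover have "ip w e = 0" "ip e w = 0" if "e \<in> E" for e
    proof -
      have e: "e \<in> V" using that E by (auto simp: orthonormal_def)
      show "ip w e = 0" using v e that perp by (simp add: w_def ip_smul)
      then show "ip e w = 0" using ip_commute w e by simp
    qed
    ultimately have "orthonormal (insert w E)" "w \<notin> E"
      using E w by (auto simp: orthonormal_def)
    then show False using max by blast
  qed
  with E show ?thesis by (rule that)
qed

text \<open>By Bessel's inequality the squared coordinates have a sum \<open>s \<le> ip v v\<close>. The residuals along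
  finite sets whose partial sums approach \<open>s\<close> form a Cauchy sequence, and its limit is orthogonal
  to the whole basis, hence zero; so \<open>s = ip v v\<close>.\<close>

lemma Parseval:
  assumes E: "orthonormal E" and total: "\<And>v. \<lbrakk>v \<in> V; \<forall>e\<in>E. ip v e = 0\<rbrakk> \<Longrightarrow> v = zero"
    and v: "v \<in> V"
  shows "((\<lambda>e. (ip v e)\<^sup>2) has_sum ip v v) E"
proof -
  have EV: "E \<subseteq> V" using E by (simp add: orthonormal_def)
  let ?q = "\<lambda>e. (ip v e)\<^sup>2"
  have bessel: "sum ?q F \<le> ip v v" if F: "finite F" "F \<subseteq> E" for F
  proof -
    obtain es where es: "set es = F" "distinct es" using finite_distinct_list[OF F(1)] by metis
    have "residual v es \<in> V" using es that EV v by (intro residual_closed) auto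
    then have "0 \<le> ip (residual v es) (residual v es)" by (rule ip_nonneg)
    then show ?thesis using ip_residual_residual[OF E, of es es v] es that v by simp
  qed
  have "?q summable_on E"
    by (rule nonneg_bdd_above_summable_on) (auto intro!: bdd_aboveI[of _ "ip v v"] bessel)
  then obtain s where s: "(?q has_sum s) E" by (auto simp: summable_on_def)
  have below: "sum ?q F \<le> s" if "finite F" "F \<subseteq> E" for F
    using finite_sum_le_has_sum[OF s that] by simp
  have "\<exists>es. set es \<subseteq> E \<and> distinct es \<and> s - 1 / real (Suc n) \<le> sum ?q (set es)" for n
  proof -
    obtain F where F: "finite F" "F \<subseteq> E" "dist (sum ?q F) s \<le> 1 / real (Suc n)"
      using has_sum_finite_approximation[OF s, of "1 / real (Suc n)"] by auto
    moreover obtain es where "set es = F" "distinct es"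
      using finite_distinct_list[OF F(1)] by metis
    ultimately show ?thesis by (intro exI[of _ es]) (auto simp: dist_real_def abs_le_iff)
  qed
  then obtain es where es: "\<And>n. set (es n) \<subseteq> E" "\<And>n. distinct (es n)"
      "\<And>n. s - 1 / real (Suc n) \<le> sum ?q (set (es n))"
    by metis
  define r where "r n = residual v (es n)" for n
  have rV: "r n \<in> V" for n using es(1) EV v by (auto simp: r_def intro!: residual_closed)
  have r_ip: "ip (r m) (r n) = ip v v - sum ?q (set (es m) \<union> set (es n))" for m n
    unfolding r_def by (rule ip_residual_residual[OF E es(1,2) es(1,2) v])
  have cauchy: "(ip_dist add smul ip (r m) (r n))\<^sup>2 \<le> 1 / real (Suc m) + 1 / real (Suc n)" for m n
  proof -
    have "(ip_dist add smul ip (r m) (r n))\<^sup>2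
        = 2 * sum ?q (set (es m) \<union> set (es n)) - sum ?q (set (es m)) - sum ?q (set (es n))"
      by (simp add: ip_dist_square rV r_ip)
    moreover have "sum ?q (set (es m) \<union> set (es n)) \<le> s" using es(1) by (intro below) auto
    ultimately show ?thesis using es(3)[of m] es(3)[of n] by simp
  qed
  have inv0: "(\<lambda>n. 1 / real (Suc n)) \<longlonglongrightarrow> 0" using LIMSEQ_inverse_real_of_nat by (simp add: inverse_eq_divide)
  have "\<exists>l\<in>V. (\<lambda>n. ip_dist add smul ip (r n) l) \<longlonglongrightarrow> 0"
  proof (rule complete[OF rV])
    fix e :: real assume e: "e > 0"
    then have "\<forall>\<^sub>F n in sequentially. 1 / real (Suc n) < e\<^sup>2 / 2"
      using inv0 by (intro order_tendstoD) auto
    then obtain N where N: "\<And>n. n \<ge> N \<Longrightarrow> 1 / real (Suc n) < e\<^sup>2 / 2"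
      unfolding eventually_sequentially by blast
    have "ip_dist add smul ip (r m) (r n) < e" if "m \<ge> N" "n \<ge> N" for m n
    proof -
      have "(ip_dist add smul ip (r m) (r n))\<^sup>2 < e\<^sup>2" using cauchy[of m n] N[OF that(1)] N[OF that(2)] by linarith
      then show ?thesis using e by (intro power2_less_imp_less[of _ e]) auto
    qed
    then show "\<exists>N. \<forall>m\<ge>N. \<forall>n\<ge>N. ip_dist add smul ip (r m) (r n) < e" by blast
  qed
  then obtain l where l: "l \<in> V" "(\<lambda>n. ip_dist add smul ip (r n) l) \<longlonglongrightarrow> 0" by blast
  have "ip l e = 0" if e: "e \<in> E" for e
  proof -
    have "(ip (r n) e)\<^sup>2 \<le> 1 / real (Suc n)" for n
    proof (cases "e \<in> set (es n)")
      case True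
      then show ?thesis using ip_residual_basis[OF E es(1,2) v e] by (simp add: r_def)
    next
      case False
      have "sum ?q (insert e (set (es n))) \<le> s" using es(1) e by (intro below) auto
      then show ?thesis
        using ip_residual_basis[OF E es(1,2) v e] False es(3)[of n] by (simp add: r_def)
    qed
    moreover have "(\<lambda>n. (ip (r n) e)\<^sup>2) \<longlonglongrightarrow> (ip l e)\<^sup>2"
      using e EV by (intro tendsto_power tendsto_ip rV l) auto
    ultimately have "(ip l e)\<^sup>2 \<le> 0" using inv0 LIMSEQ_le by blast
    then show ?thesis by simp
  qed
  then have "l = zero" using total l by blast
  then have "(\<lambda>n. (ip_dist add smul ip (r n) zero)\<^sup>2) \<longlonglongrightarrow> 0\<^sup>2"
    using l by (intro tendsto_power) simp
  moreover have "(ip_dist add smul ip (r n) zero)\<^sup>2 = ip v v - sum ?q (set (es n))" for n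
    using ip_zero[OF zero_closed] ip_zero[OF rV] ip_commute[OF rV zero_closed]
    by (simp add: ip_dist_square rV zero_closed r_ip)
  ultimately have "(\<lambda>n. ip v v - sum ?q (set (es n))) \<longlonglongrightarrow> 0" by simp
  moreover have "ip v v - s \<le> ip v v - sum ?q (set (es n))" for n
    using below[of "set (es n)"] es(1) by simp
  ultimately have "ip v v - s \<le> 0" by (intro LIMSEQ_le_const) auto
  moreover have "s \<le> ip v v" using s bessel has_sum_le_finite_sums by blast
  ultimately show ?thesis using s by simp
qed

end

section \<open>Coarse kernels\<close>

text \<open>Coarse embeddability into a Hilbert space is a statement about squared distances in an
  \<open>\<ell>\<^sup>2\<close> space. These are easier to combine than embeddings, since they just add up.
  The family \<open>F\<close> need not consist of square-summable functions: only the differences matter.\<close>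

definition sq_dist_kernel :: "'a set \<Rightarrow> ('a \<Rightarrow> 'i \<Rightarrow> real) \<Rightarrow> ('a \<Rightarrow> 'a \<Rightarrow> real) \<Rightarrow> bool" where
  "sq_dist_kernel S F N \<longleftrightarrow> (\<forall>a\<in>S. \<forall>b\<in>S. ((\<lambda>i. (F a i - F b i)\<^sup>2) has_sum N a b) UNIV)"

definition coarse_kernel :: "'a metric \<Rightarrow> ('a \<Rightarrow> 'a \<Rightarrow> real) \<Rightarrow> bool" where
  "coarse_kernel X N \<longleftrightarrow>
     (\<forall>R. \<exists>B. \<forall>a\<in>mspace X. \<forall>b\<in>mspace X. mdist X a b \<le> R \<longrightarrow> N a b \<le> B) \<and>
     (\<forall>B. \<exists>R. \<forall>a\<in>mspace X. \<forall>b\<in>mspace X. N a b \<le> B \<longrightarrow> mdist X a b \<le> R)"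

lemma coarse_kernel_upper:
  assumes "coarse_kernel X N"
  obtains B where "\<And>a b. \<lbrakk>a \<in> mspace X; b \<in> mspace X; mdist X a b \<le> R\<rbrakk> \<Longrightarrow> N a b \<le> B" "B \<ge> 0"
proof -
  obtain B where B: "\<forall>a\<in>mspace X. \<forall>b\<in>mspace X. mdist X a b \<le> R \<longrightarrow> N a b \<le> B"
    using assms[unfolded coarse_kernel_def, THEN conjunct1, THEN spec, of R] by (elim exE)
  have "N a b \<le> max B 0" if "a \<in> mspace X" "b \<in> mspace X" "mdist X a b \<le> R" for a b
    using B[rule_format, OF that] by simp
  then show ?thesis using that[of "max B 0"] by simp
qed

lemma coarse_kernel_lower:
  assumes "coarse_kernel X N"
  obtains R where "\<And>a b. \<lbrakk>a \<in> mspace X; b \<in> mspace X; N a b \<le> B\<rbrakk> \<Longrightarrow> mdist X a b \<le> R" "R \<ge> 0"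
proof -
  obtain R where R: "\<forall>a\<in>mspace X. \<forall>b\<in>mspace X. N a b \<le> B \<longrightarrow> mdist X a b \<le> R"
    using assms[unfolded coarse_kernel_def, THEN conjunct2, THEN spec, of B] by (elim exE)
  have "mdist X a b \<le> max R 0" if "a \<in> mspace X" "b \<in> mspace X" "N a b \<le> B" for a b
    using R[rule_format, OF that] by simp
  then show ?thesis using that[of "max R 0"] by simp
qed

lemma sq_dist_kernel_nonneg: "\<lbrakk>sq_dist_kernel S F N; a \<in> S; b \<in> S\<rbrakk> \<Longrightarrow> 0 \<le> N a b"
  unfolding sq_dist_kernel_def by (blast intro: has_sum_nonneg zero_le_power2)

lemma sq_dist_kernel_diag: "\<lbrakk>sq_dist_kernel S F N; a \<in> S\<rbrakk> \<Longrightarrow> N a a = 0"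
  unfolding sq_dist_kernel_def by (auto dest!: bspec[of S _ a] dest: has_sum_unique[OF _ has_sum_0])

lemma coarse_embedding_kernel:
  assumes "coarse_embedding X V \<delta> f"
    and nonneg: "\<And>a b. \<lbrakk>a \<in> mspace X; b \<in> mspace X\<rbrakk> \<Longrightarrow> 0 \<le> \<delta> (f a) (f b)"
  shows "coarse_kernel X (\<lambda>a b. (\<delta> (f a) (f b))\<^sup>2)"
proof -
  obtain \<rho>\<^sub>1 \<rho>\<^sub>2 where \<rho>: "mono_on {0..} \<rho>\<^sub>2" "filterlim \<rho>\<^sub>1 at_top at_top"
    "\<And>x x'. \<lbrakk>x \<in> mspace X; x' \<in> mspace X\<rbrakk> \<Longrightarrow>
       \<rho>\<^sub>1 (mdist X x x') \<le> \<delta> (f x) (f x') \<and> \<delta> (f x) (f x') \<le> \<rho>\<^sub>2 (mdist X x x')"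
    using assms unfolding coarse_embedding_def by blast
  have "\<exists>B. \<forall>a\<in>mspace X. \<forall>b\<in>mspace X. mdist X a b \<le> R \<longrightarrow> (\<delta> (f a) (f b))\<^sup>2 \<le> B" for R
  proof (intro exI ballI impI)
    fix a b assume ab: "a \<in> mspace X" "b \<in> mspace X" "mdist X a b \<le> R"
    have "\<rho>\<^sub>2 (mdist X a b) \<le> \<rho>\<^sub>2 R"
      using ab mdist_nonneg[of X a b] order_trans[OF mdist_nonneg[of X a b] ab(3)]
      by (intro mono_onD[OF \<rho>(1)]) auto
    then show "(\<delta> (f a) (f b))\<^sup>2 \<le> (\<rho>\<^sub>2 R)\<^sup>2"
      using \<rho>(3)[OF ab(1,2)] nonneg[OF ab(1,2)] by (intro power_mono) auto
  qed
  moreover have "\<exists>R. \<forall>a\<in>mspace X. \<forall>b\<in>mspace X. (\<delta> (f a) (f b))\<^sup>2 \<le> B \<longrightarrow> mdist X a b \<le> R" for B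
  proof -
    have "\<forall>\<^sub>F t in at_top. sqrt B < \<rho>\<^sub>1 t" using \<rho>(2) by (simp add: filterlim_at_top_dense)
    then obtain R where R: "\<And>t. t \<ge> R \<Longrightarrow> sqrt B < \<rho>\<^sub>1 t" unfolding eventually_at_top_linorder by blast
    have "mdist X a b \<le> R" if "a \<in> mspace X" "b \<in> mspace X" "(\<delta> (f a) (f b))\<^sup>2 \<le> B" for a b
    proof (rule ccontr)
      assume "\<not> mdist X a b \<le> R"
      then have "sqrt B < \<delta> (f a) (f b)" using R[of "mdist X a b"] \<rho>(3)[OF that(1,2)] by simp
      then show False using that(3) nonneg[OF that(1,2)] real_le_rsqrt[of "\<delta> (f a) (f b)" B] by simp
    qed
    then show ?thesis by blast
  qed
  ultimately show ?thesis unfolding coarse_kernel_def by blast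
qed

text \<open>Coordinates with respect to an orthonormal basis, extended by \<open>0\<close> to all indices.\<close>

lemma hilbert_coarsely_embeddable_coordinates:
  fixes X :: "'a metric"
  assumes "hilbert_coarsely_embeddable X"
  obtains F :: "'a \<Rightarrow> ('a \<Rightarrow> real) \<Rightarrow> real" and N
  where "sq_dist_kernel (mspace X) F N" "coarse_kernel X N"
    "\<And>a. a \<in> mspace X \<Longrightarrow> (\<lambda>i. (F a i)\<^sup>2) summable_on UNIV"
proof -
  obtain V :: "('a \<Rightarrow> real) set" and add zero smul ip f
    where H: "hilbert_space V add zero smul ip" and f: "coarse_embedding X V (ip_dist add smul ip) f"
    using assms unfolding hilbert_coarsely_embeddable_def by blast
  interpret hilbert_space V add zero smul ip by (rule H)
  obtain E where E: "orthonormal E" "\<And>v. \<lbrakk>v \<in> V; \<forall>e\<in>E. ip v e = 0\<rbrakk> \<Longrightarrow> v = zero"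
    using exists_total_orthonormal by blast
  have EV: "E \<subseteq> V" using E by (simp add: orthonormal_def)
  have fV: "f a \<in> V" if "a \<in> mspace X" for a using f that by (auto simp: coarse_embedding_def)
  define F where "F a e = (if e \<in> E then ip (f a) e else 0)" for a e
  have sum: "((\<lambda>e. (if e \<in> E then ip v e else 0)\<^sup>2) has_sum ip v v) UNIV" if "v \<in> V" for v
  proof -
    have "((\<lambda>e. (ip v e)\<^sup>2) has_sum ip v v) E" by (rule Parseval[OF E(1) _ that]) (rule E(2))
    also have "?this \<longleftrightarrow> ?thesis" by (rule has_sum_cong_neutral) auto
    finally show ?thesis .
  qed
  define N where "N a b = (ip_dist add smul ip (f a) (f b))\<^sup>2" for a b
  have "((\<lambda>i. (F a i - F b i)\<^sup>2) has_sum N a b) UNIV" if ab: "a \<in> mspace X" "b \<in> mspace X" for a b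
  proof -
    let ?w = "add (f a) (smul (- 1) (f b))"
    have w: "?w \<in> V" using ab fV by (simp add: add_closed smul_closed)
    have "F a e - F b e = (if e \<in> E then ip ?w e else 0)" for e
      using ab fV EV by (auto simp: F_def ip_add ip_smul smul_closed)
    moreover have "N a b = ip ?w ?w" using w by (simp add: N_def ip_dist_def ip_nonneg)
    ultimately show ?thesis using sum[OF w] by simp
  qed
  then have 1: "sq_dist_kernel (mspace X) F N" by (simp add: sq_dist_kernel_def)
  have 2: "(\<lambda>i. (F a i)\<^sup>2) summable_on UNIV" if "a \<in> mspace X" for a
    using sum[OF fV[OF that]] unfolding F_def by (rule has_sum_imp_summable)
  have "0 \<le> ip_dist add smul ip (f a) (f b)" if "a \<in> mspace X" "b \<in> mspace X" for a b
    using that fV by (simp add: ip_dist_def ip_nonneg add_closed smul_closed)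
  then have 3: "coarse_kernel X N"
    unfolding N_def[abs_def] by (rule coarse_embedding_kernel[OF f])
  show ?thesis by (rule that[OF 1 3 2])
qed

subsection \<open>The Hilbert space of square-summable families\<close>

definition l2_carrier :: "('i \<Rightarrow> real) set" where
  "l2_carrier = {a. (\<lambda>i. (a i)\<^sup>2) summable_on UNIV}"

definition l2_ip :: "('i \<Rightarrow> real) \<Rightarrow> ('i \<Rightarrow> real) \<Rightarrow> real" where
  "l2_ip a b = (\<Sum>\<^sub>\<infinity>i. a i * b i)"

lemma sum_squares_bound: "((x::real) + y)\<^sup>2 \<le> 2 * x\<^sup>2 + 2 * y\<^sup>2"
  using zero_le_power2[of "x - y"] by (simp add: power2_eq_square algebra_simps)

lemma l2_add: "\<lbrakk>a \<in> l2_carrier; b \<in> l2_carrier\<rbrakk> \<Longrightarrow> (\<lambda>i. a i + b i) \<in> l2_carrier"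
  unfolding l2_carrier_def mem_Collect_eq
  by (rule summable_on_comparison_test[of "\<lambda>i. 2 * (a i)\<^sup>2 + 2 * (b i)\<^sup>2"])
    (auto intro!: summable_on_add summable_on_cmult_right sum_squares_bound)

lemma l2_smul: "a \<in> l2_carrier \<Longrightarrow> (\<lambda>i. c * a i) \<in> l2_carrier"
  by (simp add: l2_carrier_def power_mult_distrib summable_on_cmult_right)

lemma l2_diff: "\<lbrakk>a \<in> l2_carrier; b \<in> l2_carrier\<rbrakk> \<Longrightarrow> (\<lambda>i. a i - b i) \<in> l2_carrier"
  using l2_add[of a "\<lambda>i. (- 1) * b i"] l2_smul[of b "- 1"] by simp

text \<open>Polarization writes the product as a combination of squares of square-summable families.\<close>

lemma l2_mult_summable:
  assumes "a \<in> l2_carrier" "b \<in> l2_carrier"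
  shows "(\<lambda>i. a i * b i) summable_on UNIV"
proof -
  have "(\<lambda>i. (a i + b i)\<^sup>2) summable_on UNIV" "(\<lambda>i. (a i - b i)\<^sup>2) summable_on UNIV"
    using l2_add[OF assms] l2_diff[OF assms] by (simp_all add: l2_carrier_def)
  then have "(\<lambda>i. (1 / 4) * ((a i + b i)\<^sup>2 + (- 1) * (a i - b i)\<^sup>2)) summable_on UNIV"
    by (intro summable_on_cmult_right summable_on_add)
  also have "(\<lambda>i. (1 / 4) * ((a i + b i)\<^sup>2 + (- 1) * (a i - b i)\<^sup>2)) = (\<lambda>i. a i * b i)"
    by (auto simp: power2_eq_square algebra_simps)
  finally show ?thesis .
qed

lemma l2_ip_add:
  assumes "a \<in> l2_carrier" "b \<in> l2_carrier" "c \<in> l2_carrier"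
  shows "l2_ip (\<lambda>i. a i + b i) c = l2_ip a c + l2_ip b c"
  unfolding l2_ip_def distrib_right by (intro infsum_add l2_mult_summable assms)

lemma l2_ip_smul: "l2_ip (\<lambda>i. c * a i) b = c * l2_ip a b"
  unfolding l2_ip_def by (simp add: mult.assoc infsum_cmult_right')

abbreviation l2_dist :: "('i \<Rightarrow> real) \<Rightarrow> ('i \<Rightarrow> real) \<Rightarrow> real" where
  "l2_dist \<equiv> ip_dist (\<lambda>a b i. a i + b i) (\<lambda>c a i. c * a i) l2_ip"

lemma l2_dist_eq: "l2_dist a b = sqrt (\<Sum>\<^sub>\<infinity>i. (a i - b i)\<^sup>2)"
  by (simp add: ip_dist_def l2_ip_def power2_eq_square)

lemma l2_dist_finite_sum:
  assumes "a \<in> l2_carrier" "b \<in> l2_carrier" "finite F"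
  shows "(\<Sum>i\<in>F. (a i - b i)\<^sup>2) \<le> (l2_dist a b)\<^sup>2"
proof -
  have "(\<lambda>i. (a i - b i)\<^sup>2) summable_on UNIV"
    using l2_diff[OF assms(1,2)] by (simp add: l2_carrier_def)
  then have "(\<Sum>i\<in>F. (a i - b i)\<^sup>2) \<le> (\<Sum>\<^sub>\<infinity>i. (a i - b i)\<^sup>2)"
    using assms by (intro finite_sum_le_infsum) auto
  then show ?thesis by (simp add: l2_dist_eq infsum_nonneg)
qed

text \<open>A Cauchy sequence converges coordinatewise, and the bounds on finite partial sums pass to the
  coordinatewise limit.\<close>

lemma l2_complete:
  assumes s: "\<And>n. s n \<in> l2_carrier"
    and cauchy: "\<And>e. e > 0 \<Longrightarrow> \<exists>N. \<forall>m\<ge>N. \<forall>n\<ge>N. l2_dist (s m) (s n) < e"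
  shows "\<exists>l\<in>l2_carrier. (\<lambda>n. l2_dist (s n) l) \<longlonglongrightarrow> 0"
proof -
  have nonneg: "0 \<le> l2_dist a b" for a b :: "'a \<Rightarrow> real"
    by (simp add: l2_dist_eq infsum_nonneg)
  have "Cauchy (\<lambda>n. s n i)" for i
  proof (rule metric_CauchyI)
    fix e :: real assume "e > 0"
    then obtain N where N: "\<And>m n. \<lbrakk>m \<ge> N; n \<ge> N\<rbrakk> \<Longrightarrow> l2_dist (s m) (s n) < e" using cauchy by metis
    have "dist (s m i) (s n i) < e" if "m \<ge> N" "n \<ge> N" for m n
    proof -
      have "(s m i - s n i)\<^sup>2 \<le> (l2_dist (s m) (s n))\<^sup>2"
        using l2_dist_finite_sum[OF s s, of "{i}" m n] by simp
      then have "\<bar>s m i - s n i\<bar> \<le> l2_dist (s m) (s n)"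
        using abs_le_square_iff[of "s m i - s n i" "l2_dist (s m) (s n)"] nonneg[of "s m" "s n"] by simp
      then show ?thesis using N[OF that] by (simp add: dist_real_def)
    qed
    then show "\<exists>N. \<forall>m\<ge>N. \<forall>n\<ge>N. dist (s m i) (s n i) < e" by blast
  qed
  then have "\<exists>x. (\<lambda>n. s n i) \<longlonglongrightarrow> x" for i
    using Cauchy_convergent convergent_def by blast
  then obtain l where l: "\<And>i. (\<lambda>n. s n i) \<longlonglongrightarrow> l i" by metis
  have part: "(\<Sum>i\<in>F. (s n i - l i)\<^sup>2) \<le> e\<^sup>2"
    if e: "e > 0" and N: "\<forall>m\<ge>N. \<forall>n\<ge>N. l2_dist (s m) (s n) < e" and n: "n \<ge> N" and F: "finite F"
    for e N n F
  proof (rule LIMSEQ_le_const2)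
    show "(\<lambda>m. \<Sum>i\<in>F. (s n i - s m i)\<^sup>2) \<longlonglongrightarrow> (\<Sum>i\<in>F. (s n i - l i)\<^sup>2)"
      by (intro tendsto_intros l)
    have "(\<Sum>i\<in>F. (s n i - s m i)\<^sup>2) \<le> e\<^sup>2" if m: "m \<ge> N" for m
    proof -
      have "(l2_dist (s n) (s m))\<^sup>2 \<le> e\<^sup>2"
        using N n m nonneg[of "s n" "s m"] by (intro power_mono) (auto intro: less_imp_le)
      with l2_dist_finite_sum[OF s s F, of n m] show ?thesis by linarith
    qed
    then show "\<exists>M. \<forall>m\<ge>M. (\<Sum>i\<in>F. (s n i - s m i)\<^sup>2) \<le> e\<^sup>2" by blast
  qed
  have diff: "(\<lambda>i. s n i - l i) \<in> l2_carrier" and dist: "l2_dist (s n) l \<le> e"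
    if e: "e > 0" and N: "\<forall>m\<ge>N. \<forall>n\<ge>N. l2_dist (s m) (s n) < e" and n: "n \<ge> N" for e N n
  proof -
    have sm: "(\<lambda>i. (s n i - l i)\<^sup>2) summable_on UNIV"
      by (rule nonneg_bdd_above_summable_on) (auto intro!: bdd_aboveI[of _ "e\<^sup>2"] part[OF e N n])
    then show "(\<lambda>i. s n i - l i) \<in> l2_carrier" by (simp add: l2_carrier_def)
    have "(\<Sum>\<^sub>\<infinity>i. (s n i - l i)\<^sup>2) \<le> e\<^sup>2"
      using sm by (rule infsum_le_finite_sums) (use part[OF e N n] in auto)
    then have "sqrt (\<Sum>\<^sub>\<infinity>i. (s n i - l i)\<^sup>2) \<le> sqrt (e\<^sup>2)" by (rule real_sqrt_le_mono)
    then show "l2_dist (s n) l \<le> e" using e by (simp add: l2_dist_eq)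
  qed
  obtain N where N: "\<forall>m\<ge>N. \<forall>n\<ge>N. l2_dist (s m) (s n) < 1" using cauchy[of 1] by auto
  have "(\<lambda>i. s N i - (s N i - l i)) \<in> l2_carrier"
    by (rule l2_diff[OF s diff[OF _ N]]) auto
  then have "l \<in> l2_carrier" by simp
  moreover have "(\<lambda>n. l2_dist (s n) l) \<longlonglongrightarrow> 0"
  proof (rule LIMSEQ_I)
    fix r :: real assume "r > 0"
    then obtain N where N: "\<forall>m\<ge>N. \<forall>n\<ge>N. l2_dist (s m) (s n) < r / 2" using cauchy[of "r / 2"] by auto
    have "norm (l2_dist (s n) l - 0) < r" if "n \<ge> N" for n
      using dist[OF _ N that] \<open>r > 0\<close> nonneg[of "s n" l] by simp
    then show "\<exists>N. \<forall>n\<ge>N. norm (l2_dist (s n) l - 0) < r" by blast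
  qed
  ultimately show ?thesis by blast
qed

lemma hilbert_space_l2:
  "hilbert_space l2_carrier (\<lambda>a b i. a i + b i) (\<lambda>_. 0) (\<lambda>c a i. c * a i) l2_ip"
proof (unfold_locales, goal_cases)
  case (16 u)
  then have "(\<lambda>i. (u i)\<^sup>2) summable_on UNIV" "(\<Sum>\<^sub>\<infinity>i. (u i)\<^sup>2) = 0"
    by (auto simp: l2_carrier_def l2_ip_def power2_eq_square)
  then have "(u i)\<^sup>2 = 0" for i
    using nonneg_infsum_le_0D[of "\<lambda>i. (u i)\<^sup>2" UNIV i] by simp
  then show ?case by (simp add: fun_eq_iff)
next
  case (17 s)
  then show ?case by (rule l2_complete)
qed (auto simp: l2_add l2_smul l2_ip_add l2_ip_smul algebra_simps,
    auto simp: l2_carrier_def l2_ip_def mult.commute infsum_nonneg)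

text \<open>The base point \<open>a0\<close> makes the coordinates square-summable. The moduli are the pointwise best
  ones; the infimum and the supremum are taken together with \<open>t\<close>, which keeps them finite and makes
  them tend to infinity even if the space is bounded.\<close>

theorem hilbert_coarsely_embeddable_kernelI:
  fixes F :: "'a \<Rightarrow> 'i \<Rightarrow> real"
  assumes F: "sq_dist_kernel (mspace X) F N" and N: "coarse_kernel X N"
  shows "hilbert_coarsely_embeddable X"
proof -
  define a0 where "a0 = (SOME a. a \<in> mspace X)"
  define f where "f a i = F a i - F a0 i" for a i
  have a0: "a0 \<in> mspace X" if "a \<in> mspace X" for a using that unfolding a0_def by (rule someI)
  have f: "f a \<in> l2_carrier" if "a \<in> mspace X" for a
    using F that a0[OF that] unfolding sq_dist_kernel_def f_def l2_carrier_def
    by (auto intro: has_sum_imp_summable)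
  have dist: "l2_dist (f a) (f b) = sqrt (N a b)" if "a \<in> mspace X" "b \<in> mspace X" for a b
    using F that by (simp add: l2_dist_eq f_def sq_dist_kernel_def infsumI)
  define L where "L t = insert t {sqrt (N a b) | a b. a \<in> mspace X \<and> b \<in> mspace X \<and> t \<le> mdist X a b}" for t
  define U where "U t = insert t {sqrt (N a b) | a b. a \<in> mspace X \<and> b \<in> mspace X \<and> mdist X a b \<le> t}" for t
  have L0: "0 \<le> x" if "x \<in> L t" "0 \<le> t" for x t
    using that sq_dist_kernel_nonneg[OF F] by (auto simp: L_def)
  have L_bdd: "bdd_below (L t)" if "0 \<le> t" for t using L0 that by (intro bdd_belowI) blast
  have U_bdd: "bdd_above (U t)" for t
  proof -
    obtain B where "\<And>a b. \<lbrakk>a \<in> mspace X; b \<in> mspace X; mdist X a b \<le> t\<rbrakk> \<Longrightarrow> N a b \<le> B"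
      using coarse_kernel_upper[OF N] by metis
    then show ?thesis by (intro bdd_aboveI[of _ "max t (sqrt B)"]) (auto simp: U_def le_max_iff_disj)
  qed
  have L_mem: "sqrt (N a b) \<in> L (mdist X a b)" and U_mem: "sqrt (N a b) \<in> U (mdist X a b)"
    if "a \<in> mspace X" "b \<in> mspace X" for a b using that by (auto simp: L_def U_def)
  have t_mem: "t \<in> L t" "t \<in> U t" for t by (auto simp: L_def U_def)
  have "\<exists>T. \<forall>t\<ge>T. M \<le> Inf (L t)" for M
  proof -
    obtain R where R: "\<And>a b. \<lbrakk>a \<in> mspace X; b \<in> mspace X; N a b \<le> M\<^sup>2\<rbrakk> \<Longrightarrow> mdist X a b \<le> R"
      using coarse_kernel_lower[OF N] by metis
    have "M \<le> Inf (L t)" if t: "t \<ge> max M (R + 1)" for t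
    proof (rule cInf_greatest)
      fix x assume "x \<in> L t"
      then consider "x = t" | a b where "x = sqrt (N a b)" "a \<in> mspace X" "b \<in> mspace X" "t \<le> mdist X a b"
        by (auto simp: L_def)
      then show "M \<le> x"
      proof cases
        case 2
        then have "M\<^sup>2 \<le> N a b" using R[of a b] t by force
        then show ?thesis using 2 real_le_rsqrt by simp
      qed (use t in auto)
    qed (use t_mem in auto)
    then show ?thesis by blast
  qed
  then have L_lim: "filterlim (\<lambda>t. Inf (L t)) at_top at_top"
    unfolding filterlim_at_top eventually_at_top_linorder by blast
  have L_mono: "mono_on {0..} (\<lambda>t. Inf (L t))"
  proof (rule mono_onI)
    fix r t :: real assume rt: "r \<in> {0..}" "r \<le> t"
    show "Inf (L r) \<le> Inf (L t)"
    proof (rule cInf_greatest)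
      fix x assume "x \<in> L t"
      then consider "x = t" | "x \<in> L r" unfolding L_def using order_trans[OF rt(2)] by blast
      then show "Inf (L r) \<le> x"
        using rt cInf_lower[OF t_mem(1) L_bdd, of r] cInf_lower[OF _ L_bdd, of x r] by cases auto
    qed (use t_mem in auto)
  qed
  have U_ge: "t \<le> Sup (U t)" for t by (rule cSup_upper[OF t_mem(2) U_bdd])
  have U_lim: "filterlim (\<lambda>t. Sup (U t)) at_top at_top"
    by (rule filterlim_at_top_mono[OF filterlim_ident]) (simp add: U_ge)
  have U_mono: "mono_on {0..} (\<lambda>t. Sup (U t))"
  proof (rule mono_onI)
    fix r t :: real assume rt: "r \<le> t"
    show "Sup (U r) \<le> Sup (U t)"
    proof (rule cSup_least)
      fix x assume "x \<in> U r"
      then consider "x = r" | "x \<in> U t" unfolding U_def using order_trans[OF _ rt] by blast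
      then show "x \<le> Sup (U t)"
        using rt U_ge[of t] cSup_upper[OF _ U_bdd, of x t] by cases auto
    qed (use t_mem in auto)
  qed
  have "coarse_embedding X l2_carrier l2_dist f"
    unfolding coarse_embedding_def
  proof (intro conjI exI ballI)
    show "f \<in> mspace X \<rightarrow> l2_carrier" using f by blast
    show "(\<lambda>t. Inf (L t)) \<in> {0..} \<rightarrow> {0..}"
    proof
      fix t :: real assume "t \<in> {0..}"
      then show "Inf (L t) \<in> {0..}"
        using t_mem(1)[of t] L0[of _ t] cInf_greatest[of "L t" 0] by auto
    qed
    show "(\<lambda>t. Sup (U t)) \<in> {0..} \<rightarrow> {0..}"
    proof
      fix t :: real assume "t \<in> {0..}"
      then show "Sup (U t) \<in> {0..}" using U_ge[of t] by simp
    qed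
    fix a b assume ab: "a \<in> mspace X" "b \<in> mspace X"
    show "Inf (L (mdist X a b)) \<le> l2_dist (f a) (f b)"
      unfolding dist[OF ab] by (rule cInf_lower[OF L_mem[OF ab] L_bdd]) simp
    show "l2_dist (f a) (f b) \<le> Sup (U (mdist X a b))"
      unfolding dist[OF ab] by (rule cSup_upper[OF U_mem[OF ab] U_bdd])
  qed (fact L_mono L_lim U_mono U_lim)+
  then show ?thesis by (rule hilbert_coarsely_embeddableI[OF hilbert_space_l2])
qed

lemma sq_dist_kernel_add:
  assumes "sq_dist_kernel S F N" "sq_dist_kernel S G M"
  shows "sq_dist_kernel S (\<lambda>a. case_sum (F a) (G a)) (\<lambda>a b. N a b + M a b)"
  unfolding sq_dist_kernel_def
proof (intro ballI)
  fix a b assume "a \<in> S" "b \<in> S"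
  then have "((\<lambda>i. (F a i - F b i)\<^sup>2) has_sum N a b) UNIV" "((\<lambda>i. (G a i - G b i)\<^sup>2) has_sum M a b) UNIV"
    using assms by (auto simp: sq_dist_kernel_def)
  then have "((\<lambda>i. (case_sum (F a) (G a) i - case_sum (F b) (G b) i)\<^sup>2) has_sum N a b) (range Inl)"
    "((\<lambda>i. (case_sum (F a) (G a) i - case_sum (F b) (G b) i)\<^sup>2) has_sum M a b) (range Inr)"
    by (simp_all add: has_sum_reindex o_def)
  then have "((\<lambda>i. (case_sum (F a) (G a) i - case_sum (F b) (G b) i)\<^sup>2) has_sum N a b + M a b)
      (range Inl \<union> range Inr)"
    by (rule has_sum_Un_disjoint) auto
  then show "((\<lambda>i. (case_sum (F a) (G a) i - case_sum (F b) (G b) i)\<^sup>2) has_sum N a b + M a b) UNIV"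
    by (simp add: UNIV_sum)
qed

section \<open>Gaussian kernels and geometric rounding\<close>

lemma has_sum_prod_nonneg:
  fixes f :: "'a \<times> 'b \<Rightarrow> real"
  assumes "\<And>x. ((\<lambda>y. f (x, y)) has_sum g x) UNIV" "(g has_sum S) UNIV" "\<And>x y. 0 \<le> f (x, y)"
  shows "(f has_sum S) UNIV"
proof -
  have "f summable_on Sigma UNIV (\<lambda>_. UNIV)"
    by (rule summable_on_SigmaI[where g = g]) (use assms has_sum_imp_summable[OF assms(2)] in auto)
  then have "(f has_sum S) (Sigma UNIV (\<lambda>_. UNIV))"
    by (intro has_sum_SigmaI[where g = g]) (use assms in auto)
  then show ?thesis by simp
qed

text \<open>Splitting each coordinate into its positive and its negative part changes squared distances
  by a factor of at most \<open>2\<close>.\<close>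

lemma nonneg_coordinates:
  fixes F :: "'a \<Rightarrow> 'i \<Rightarrow> real"
  assumes F: "sq_dist_kernel (mspace X) F N" and N: "coarse_kernel X N"
    and l2: "\<And>a. a \<in> mspace X \<Longrightarrow> (\<lambda>i. (F a i)\<^sup>2) summable_on UNIV"
  obtains G :: "'a \<Rightarrow> 'i \<times> bool \<Rightarrow> real" and M
  where "sq_dist_kernel (mspace X) G M" "coarse_kernel X M" "\<And>a i. 0 \<le> G a i"
    "\<And>a. a \<in> mspace X \<Longrightarrow> (\<lambda>i. (G a i)\<^sup>2) summable_on UNIV"
proof -
  define G where "G a = (\<lambda>(i, \<sigma>). max 0 (if \<sigma> then F a i else - F a i))" for a
  define h where "h a b i = (G a (i, True) - G b (i, True))\<^sup>2 + (G a (i, False) - G b (i, False))\<^sup>2" for a b i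
  have pair: "((\<lambda>\<sigma>. u (i, \<sigma>)) has_sum u (i, True) + u (i, False)) UNIV" for u :: "'i \<times> bool \<Rightarrow> real" and i
    by (rule has_sum_finiteI) (simp_all add: UNIV_bool)
  have h_le: "h a b i \<le> (F a i - F b i)\<^sup>2" and h_ge: "(F a i - F b i)\<^sup>2 \<le> 2 * h a b i" for a b i
  proof -
    have *: "(max 0 x - max 0 y)\<^sup>2 + (max 0 (- x) - max 0 (- y))\<^sup>2 \<le> (x - y)\<^sup>2 \<and>
        (x - y)\<^sup>2 \<le> 2 * ((max 0 x - max 0 y)\<^sup>2 + (max 0 (- x) - max 0 (- y))\<^sup>2)" for x y :: real
    proof -
      define u v where "u = max 0 x - max 0 y" and "v = max 0 (- x) - max 0 (- y)"
      have "x - y = u - v" "u * v \<le> 0"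
        by (auto simp: u_def v_def max_def mult_le_0_iff)
      moreover have "0 \<le> (u + v)\<^sup>2" by simp
      moreover have "(u - v)\<^sup>2 = u\<^sup>2 + v\<^sup>2 - 2 * (u * v)" "(u + v)\<^sup>2 = u\<^sup>2 + v\<^sup>2 + 2 * (u * v)"
        by (simp_all add: power2_eq_square algebra_simps)
      ultimately show ?thesis unfolding u_def[symmetric] v_def[symmetric] by simp
    qed
    show "h a b i \<le> (F a i - F b i)\<^sup>2" "(F a i - F b i)\<^sup>2 \<le> 2 * h a b i"
      using *[of "F a i" "F b i"] by (simp_all add: h_def G_def)
  qed
  have "0 \<le> h a b i" for a b i by (simp add: h_def)
  note h = this h_le h_ge
  define M where "M a b = (\<Sum>\<^sub>\<infinity>i. h a b i)" for a b
  have FN: "((\<lambda>i. (F a i - F b i)\<^sup>2) has_sum N a b) UNIV" if "a \<in> mspace X" "b \<in> mspace X" for a b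
    using F that by (simp add: sq_dist_kernel_def)
  have hM: "(h a b has_sum M a b) UNIV" if "a \<in> mspace X" "b \<in> mspace X" for a b
    unfolding M_def using h
    by (intro has_sum_infsum summable_on_comparison_test[OF has_sum_imp_summable[OF FN[OF that]]]) auto
  have M_le: "M a b \<le> N a b" if "a \<in> mspace X" "b \<in> mspace X" for a b
    using h_le by (intro has_sum_mono[OF hM FN] that)
  have M_ge: "N a b \<le> 2 * M a b" if "a \<in> mspace X" "b \<in> mspace X" for a b
    using h_ge by (intro has_sum_mono[OF FN has_sum_cmult_right[OF hM]] that)
  have 1: "sq_dist_kernel (mspace X) G M"
    unfolding sq_dist_kernel_def
  proof (intro ballI)
    fix a b assume ab: "a \<in> mspace X" "b \<in> mspace X"
    show "((\<lambda>i. (G a i - G b i)\<^sup>2) has_sum M a b) UNIV"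
      using pair[of "\<lambda>i. (G a i - G b i)\<^sup>2"]
      by (intro has_sum_prod_nonneg[OF _ hM[OF ab]]) (auto simp: h_def)
  qed
  have 2: "coarse_kernel X M"
    unfolding coarse_kernel_def
  proof (intro conjI allI)
    fix R
    obtain B where "\<And>a b. \<lbrakk>a \<in> mspace X; b \<in> mspace X; mdist X a b \<le> R\<rbrakk> \<Longrightarrow> N a b \<le> B"
      using coarse_kernel_upper[OF N] by metis
    then show "\<exists>B. \<forall>a\<in>mspace X. \<forall>b\<in>mspace X. mdist X a b \<le> R \<longrightarrow> M a b \<le> B"
      using M_le order_trans by metis
  next
    fix B
    obtain R where "\<And>a b. \<lbrakk>a \<in> mspace X; b \<in> mspace X; N a b \<le> 2 * B\<rbrakk> \<Longrightarrow> mdist X a b \<le> R"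
      using coarse_kernel_lower[OF N] by metis
    moreover have "N a b \<le> 2 * B" if "a \<in> mspace X" "b \<in> mspace X" "M a b \<le> B" for a b
      using M_ge[OF that(1,2)] that(3) by simp
    ultimately show "\<exists>R. \<forall>a\<in>mspace X. \<forall>b\<in>mspace X. M a b \<le> B \<longrightarrow> mdist X a b \<le> R"
      by blast
  qed
  have 3: "0 \<le> G a i" for a i by (simp add: G_def case_prod_unfold)
  have 4: "(\<lambda>i. (G a i)\<^sup>2) summable_on UNIV" if "a \<in> mspace X" for a
  proof -
    have "(G a (i, True))\<^sup>2 + (G a (i, False))\<^sup>2 = (F a i)\<^sup>2" for i
      by (simp add: G_def max_def)
    then have "((\<lambda>\<sigma>. (G a (i, \<sigma>))\<^sup>2) has_sum (F a i)\<^sup>2) UNIV" for i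
      using pair[of "\<lambda>i. (G a i)\<^sup>2" i] by simp
    then show ?thesis
      by (intro has_sum_imp_summable[OF has_sum_prod_nonneg[OF _ has_sum_infsum[OF l2[OF that]]]]) auto
  qed
  show ?thesis by (rule that[OF 1 2 3 4])
qed

text \<open>Expanding \<open>S ^ k\<close> by distributivity gives one term for each word of length \<open>k\<close>.\<close>

lemma has_sum_words_of_length:
  fixes c :: "'j \<Rightarrow> real"
  assumes c: "(c has_sum S) UNIV" and nonneg: "\<And>j. 0 \<le> c j"
  shows "((\<lambda>js. prod_list (map c js)) has_sum S ^ k) {js. length js = k}"
proof (induction k)
  case 0
  have "{js :: 'j list. length js = 0} = {[]}" by auto
  then show ?case by (simp add: has_sum_finite_iff)
next
  case (Suc k)
  let ?L = "{js :: 'j list. length js = k}" and ?w = "\<lambda>js. prod_list (map c js)"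
  have w: "0 \<le> ?w js" for js using nonneg by (induction js) auto
  have inner: "((\<lambda>js. c j * ?w js) has_sum c j * S ^ k) ?L" for j
    by (rule has_sum_cmult_right[OF Suc.IH])
  have outer: "((\<lambda>j. c j * S ^ k) has_sum S * S ^ k) UNIV"
    by (rule has_sum_cmult_left[OF c])
  have "(\<lambda>(j, js). c j * ?w js) summable_on Sigma UNIV (\<lambda>_. ?L)"
    by (rule summable_on_SigmaI[where g = "\<lambda>j. c j * S ^ k"])
      (use inner has_sum_imp_summable[OF outer] nonneg w in auto)
  then have "((\<lambda>(j, js). c j * ?w js) has_sum S * S ^ k) (Sigma UNIV (\<lambda>_. ?L))"
    by (intro has_sum_SigmaI[where g = "\<lambda>j. c j * S ^ k"]) (use inner outer in auto)
  moreover have "bij_betw (\<lambda>(j, js). j # js) (Sigma UNIV (\<lambda>_. ?L)) {js. length js = Suc k}"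
    by (rule bij_betwI[where g = "\<lambda>js. (hd js, tl js)"]) (auto simp: length_Suc_conv)
  from has_sum_reindex_bij_betw[OF this, of ?w "S * S ^ k"]
  have "((\<lambda>(j, js). c j * ?w js) has_sum S * S ^ k) (Sigma UNIV (\<lambda>_. ?L))
      = (?w has_sum S * S ^ k) {js. length js = Suc k}"
    by (simp add: case_prod_unfold)
  ultimately show ?case by simp
qed

lemma has_sum_words_exp:
  fixes c :: "'j \<Rightarrow> real"
  assumes c: "(c has_sum S) UNIV" and nonneg: "\<And>j. 0 \<le> c j"
  shows "((\<lambda>js. prod_list (map c js) / fact (length js)) has_sum exp S) UNIV"
proof -
  let ?w = "\<lambda>js. prod_list (map c js) / fact (length js)"
  have w: "0 \<le> prod_list (map c js)" for js using nonneg by (induction js) auto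
  have S: "0 \<le> S" using c nonneg by (auto intro: has_sum_nonneg)
  have inner: "(?w has_sum S ^ k / fact k) {js. length js = k}" for k
  proof -
    have "(?w has_sum S ^ k / fact k) {js. length js = k} \<longleftrightarrow>
        ((\<lambda>js. prod_list (map c js) / fact k) has_sum S ^ k / fact k) {js. length js = k}"
      by (rule has_sum_cong) auto
    then show ?thesis using has_sum_divide_const[OF has_sum_words_of_length[OF c nonneg]] by blast
  qed
  have "(\<lambda>k. S ^ k / fact k) sums exp S"
    using exp_converges[of S] by (simp add: divide_inverse mult.commute)
  then have outer: "((\<lambda>k. S ^ k / fact k) has_sum exp S) UNIV"
    using S by (intro sums_nonneg_imp_has_sum) auto
  let ?\<Sigma> = "Sigma UNIV (\<lambda>k. {js :: 'j list. length js = k})"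
  have "(\<lambda>(k, js). ?w js) summable_on ?\<Sigma>"
    by (rule summable_on_SigmaI[where g = "\<lambda>k. S ^ k / fact k"])
      (use inner has_sum_imp_summable[OF outer] w in auto)
  then have "((\<lambda>(k, js). ?w js) has_sum exp S) ?\<Sigma>"
    by (intro has_sum_SigmaI[where g = "\<lambda>k. S ^ k / fact k"]) (use inner outer in auto)
  moreover have "bij_betw snd ?\<Sigma> UNIV"
    by (rule bij_betwI[where g = "\<lambda>js. (length js, js)"]) auto
  from has_sum_reindex_bij_betw[OF this, of ?w "exp S"]
  have "((\<lambda>(k, js). ?w js) has_sum exp S) ?\<Sigma> = (?w has_sum exp S) UNIV"
    by (simp add: case_prod_unfold)
  ultimately show ?thesis by simp
qed

lemma prod_list_map_mult: "prod_list (map (\<lambda>j. u j * v j) js) = prod_list (map u js) * prod_list (map v js)"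
  for u v :: "'j \<Rightarrow> real"
  by (induction js) auto

text \<open>The Gaussian kernel \<open>exp (- s * M a b)\<close> is the Gram matrix of exponential vectors in the full
  Fock space, written in coordinates indexed by words. Their normalization, the factor
  \<open>exp (- s * Q a)\<close>, turns the exponent \<open>2 * s * (\<Sum>i. G a i * G b i)\<close> into \<open>- s * M a b\<close>. Since \<open>G\<close> is
  nonnegative, so are these coordinates.\<close>

lemma gaussian_unit_vectors:
  fixes G :: "'a \<Rightarrow> 'j \<Rightarrow> real"
  assumes G: "sq_dist_kernel S G M" "\<And>a i. 0 \<le> G a i"
    and l2: "\<And>a. a \<in> S \<Longrightarrow> (\<lambda>i. (G a i)\<^sup>2) summable_on UNIV" and s: "0 \<le> s"
  obtains \<xi> :: "'a \<Rightarrow> 'j list \<Rightarrow> real"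
  where "\<And>a js. 0 \<le> \<xi> a js"
    "\<And>a b. \<lbrakk>a \<in> S; b \<in> S\<rbrakk> \<Longrightarrow> ((\<lambda>js. \<xi> a js * \<xi> b js) has_sum exp (- s * M a b)) UNIV"
proof -
  define Q where "Q a = (\<Sum>\<^sub>\<infinity>i. (G a i)\<^sup>2)" for a
  define \<xi> where "\<xi> a js = exp (- s * Q a) * prod_list (map (\<lambda>i. sqrt (2 * s) * G a i) js) / sqrt (fact (length js))" for a js
  have "((\<lambda>js. \<xi> a js * \<xi> b js) has_sum exp (- s * M a b)) UNIV" if ab: "a \<in> S" "b \<in> S" for a b
  proof -
    have Q: "((\<lambda>i. (G a i)\<^sup>2) has_sum Q a) UNIV" "((\<lambda>i. (G b i)\<^sup>2) has_sum Q b) UNIV"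
      using l2 ab by (simp_all add: Q_def)
    have "((\<lambda>i. (G a i - G b i)\<^sup>2) has_sum M a b) UNIV" using G ab by (simp add: sq_dist_kernel_def)
    then have "((\<lambda>i. s * (((G a i)\<^sup>2 + (G b i)\<^sup>2) + (- 1) * (G a i - G b i)\<^sup>2)) has_sum
        s * ((Q a + Q b) + (- 1) * M a b)) UNIV"
      by (intro has_sum_cmult_right has_sum_add Q)
    also have "(\<lambda>i. s * (((G a i)\<^sup>2 + (G b i)\<^sup>2) + (- 1) * (G a i - G b i)\<^sup>2))
        = (\<lambda>i. sqrt (2 * s) * G a i * (sqrt (2 * s) * G b i))"
    proof
      fix i
      have "sqrt (2 * s) * sqrt (2 * s) = 2 * s" using s by simp
      moreover have "r * x * (r * y) = r * r * (x * y)" for r x y :: real by (simp add: ac_simps)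
      ultimately have "sqrt (2 * s) * G a i * (sqrt (2 * s) * G b i) = 2 * s * (G a i * G b i)" by metis
      moreover have "s * (((G a i)\<^sup>2 + (G b i)\<^sup>2) + (- 1) * (G a i - G b i)\<^sup>2) = 2 * s * (G a i * G b i)"
        by (simp add: power2_eq_square algebra_simps)
      ultimately show "s * (((G a i)\<^sup>2 + (G b i)\<^sup>2) + (- 1) * (G a i - G b i)\<^sup>2)
          = sqrt (2 * s) * G a i * (sqrt (2 * s) * G b i)"
        by (simp only:)
    qed
    finally have "((\<lambda>js. prod_list (map (\<lambda>i. sqrt (2 * s) * G a i * (sqrt (2 * s) * G b i)) js) / fact (length js))
        has_sum exp (s * ((Q a + Q b) + (- 1) * M a b))) UNIV"
      using G s by (intro has_sum_words_exp) auto
    then have "((\<lambda>js. exp (- s * Q a - s * Q b) *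
          (prod_list (map (\<lambda>i. sqrt (2 * s) * G a i * (sqrt (2 * s) * G b i)) js) / fact (length js)))
        has_sum exp (- s * Q a - s * Q b) * exp (s * ((Q a + Q b) + (- 1) * M a b))) UNIV"
      by (rule has_sum_cmult_right)
    moreover have "exp (- s * Q a - s * Q b) *
          (prod_list (map (\<lambda>i. sqrt (2 * s) * G a i * (sqrt (2 * s) * G b i)) js) / fact (length js))
        = \<xi> a js * \<xi> b js" for js
    proof -
      have "exp (- s * Q a - s * Q b) = exp (- s * Q a) * exp (- s * Q b)"
        by (simp add: exp_add[symmetric])
      moreover have "sqrt (fact (length js)) * sqrt (fact (length js)) = (fact (length js) :: real)" by simp
      ultimately show ?thesis unfolding \<xi>_def prod_list_map_mult[of "\<lambda>i. sqrt (2 * s) * G a i"]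
        by (simp add: field_simps)
    qed
    moreover have "exp (- s * Q a - s * Q b) * exp (s * ((Q a + Q b) + (- 1) * M a b)) = exp (- s * M a b)"
      by (simp add: exp_add[symmetric] algebra_simps)
    ultimately show ?thesis by simp
  qed
  moreover have "0 \<le> \<xi> a js" for a js
    unfolding \<xi>_def using s G(2)
    by (intro divide_nonneg_nonneg mult_nonneg_nonneg prod_list_nonneg) (auto simp: prod_list_nonneg)
  ultimately show ?thesis by (intro that)
qed

text \<open>Rounding \<open>x\<close> down to a power of \<open>1 / (1 - \<epsilon>)\<close>: the gaps between consecutive powers add up to
  the largest power below \<open>x\<close>.\<close>

lemma geometric_rounding:
  fixes \<epsilon> :: real
  assumes \<epsilon>: "0 < \<epsilon>" "\<epsilon> < 1"
  obtains rd :: "real \<Rightarrow> real"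
  where "\<And>x. x \<ge> 0 \<Longrightarrow> ((\<lambda>k. if (1 / (1 - \<epsilon>)) powi k \<le> x then \<epsilon> * (1 / (1 - \<epsilon>)) powi k else 0) has_sum rd x) UNIV"
    "\<And>x. x \<ge> 0 \<Longrightarrow> rd x \<le> x" "\<And>x. x \<ge> 0 \<Longrightarrow> (1 - \<epsilon>) * x \<le> rd x" "\<And>x y. \<lbrakk>0 \<le> x; x \<le> y\<rbrakk> \<Longrightarrow> rd x \<le> rd y"
proof -
  define q where "q = 1 / (1 - \<epsilon>)"
  have q: "q > 1" "1 / q = 1 - \<epsilon>" "\<epsilon> = 1 - 1 / q" using \<epsilon> by (auto simp: q_def field_simps)
  let ?c = "\<lambda>x k. if q powi k \<le> x then \<epsilon> * q powi k else 0"
  have level: "\<exists>r. (?c x has_sum r) UNIV \<and> r \<le> x \<and> (1 - \<epsilon>) * x \<le> r" if x: "x \<ge> 0" for x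
  proof (cases "x = 0")
    case True
    have "\<not> q powi k \<le> 0" for k using q by (simp add: not_le zero_less_power_int)
    then show ?thesis using True by (intro exI[of _ 0]) simp
  next
    case False
    define K where "K = \<lfloor>log q x\<rfloor>"
    have powi: "q powi k = q powr real_of_int k" for k using q by (simp add: powr_real_of_int')
    have le: "q powi k \<le> x \<longleftrightarrow> k \<le> K" for k
      using q x False unfolding powi K_def by (simp add: powr_le_iff le_floor_iff)
    have "((\<lambda>i. \<epsilon> * q powi K * (1 - \<epsilon>) ^ i) has_sum \<epsilon> * q powi K * (1 / (1 - (1 - \<epsilon>)))) UNIV"
      using \<epsilon> by (intro has_sum_cmult_right sums_nonneg_imp_has_sum geometric_sums) auto
    then have geo: "((\<lambda>i. \<epsilon> * q powi K * (1 - \<epsilon>) ^ i) has_sum q powi K) UNIV" using \<epsilon> by simp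
    have bij: "bij_betw (\<lambda>i. K - int i) UNIV {..K}"
      by (rule bij_betwI[where g = "\<lambda>k. nat (K - k)"]) auto
    have step: "\<epsilon> * q powi K * (1 - \<epsilon>) ^ i = \<epsilon> * q powi (K - int i)" for i
      using q by (simp add: power_int_diff q(2)[symmetric] power_one_over)
    have "((\<lambda>k. \<epsilon> * q powi k) has_sum q powi K) {..K}"
      using geo has_sum_reindex_bij_betw[OF bij, of "\<lambda>k. \<epsilon> * q powi k" "q powi K"] by (simp add: step)
    also have "?this \<longleftrightarrow> (?c x has_sum q powi K) UNIV"
      by (rule has_sum_cong_neutral) (auto simp: le)
    finally have "(?c x has_sum q powi K) UNIV" .
    moreover have "q powi K \<le> x" using le by simp
    moreover have "(1 - \<epsilon>) * x \<le> q powi K"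
    proof -
      have "x < q powi (K + 1)" using le[of "K + 1"] by simp
      also have "q powi (K + 1) = q powi K * q" using q(1) by (simp add: power_int_add)
      finally have "x / q < q powi K" using q(1) by (simp add: pos_divide_less_eq)
      moreover have "(1 - \<epsilon>) * x = x / q" unfolding q(2)[symmetric] by simp
      ultimately show ?thesis by simp
    qed
    ultimately show ?thesis by (intro exI[of _ "q powi K"] conjI)
  qed
  define rd where "rd x = (THE r. (?c x has_sum r) UNIV)" for x
  have rd: "(?c x has_sum rd x) UNIV" "rd x \<le> x" "(1 - \<epsilon>) * x \<le> rd x" if x: "x \<ge> 0" for x
  proof -
    obtain r where r: "(?c x has_sum r) UNIV" "r \<le> x" "(1 - \<epsilon>) * x \<le> r" using level[OF x] by blast
    then have "rd x = r" unfolding rd_def by (blast intro: has_sum_unique)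
    then show "(?c x has_sum rd x) UNIV" "rd x \<le> x" "(1 - \<epsilon>) * x \<le> rd x" using r by simp_all
  qed
  have "rd x \<le> rd y" if "0 \<le> x" "x \<le> y" for x y
  proof (rule has_sum_mono)
    show "(?c x has_sum rd x) UNIV" "(?c y has_sum rd y) UNIV" using rd(1) that by auto
    show "?c x k \<le> ?c y k" for k
      using that \<epsilon>(1) q(1) zero_le_power_int[of q k] by auto
  qed
  with rd show ?thesis unfolding q_def by (rule that)
qed

section \<open>Coarse cut measures\<close>

text \<open>Only cuts that contain \<open>y\<close> and omit \<open>z\<close> are counted: the total weight of the cuts containing
  a point may be infinite.\<close>

definition cut_kernel :: "'z set \<Rightarrow> ('i \<Rightarrow> real) \<Rightarrow> ('i \<Rightarrow> 'z set) \<Rightarrow> ('z \<Rightarrow> 'z \<Rightarrow> real) \<Rightarrow> bool" where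
  "cut_kernel S w A D \<longleftrightarrow> (\<forall>i. 0 \<le> w i) \<and>
     (\<forall>y\<in>S. \<forall>z\<in>S. ((\<lambda>i. if y \<in> A i \<and> z \<notin> A i then w i else 0) has_sum D y z) UNIV)"

lemma cut_kernel_nonneg:
  assumes "cut_kernel S w A D" "y \<in> S" "z \<in> S"
  shows "0 \<le> D y z"
proof -
  have "((\<lambda>i. if y \<in> A i \<and> z \<notin> A i then w i else 0) has_sum D y z) UNIV" "\<And>i. 0 \<le> w i"
    using assms by (auto simp: cut_kernel_def)
  then show ?thesis by (elim has_sum_nonneg) auto
qed

text \<open>The cuts are superlevel sets of the squared coordinates of unit vectors. A cut at the level
  \<open>q ^ k\<close> has the gap between \<open>q ^ (k - 1)\<close> and \<open>q ^ k\<close> as its weight, so for a fixed coordinate the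
  weights of the cuts that contain \<open>y\<close> and omit \<open>z\<close> add up to the positive part of
  \<open>(\<xi> y j)\<^sup>2 - (\<xi> z j)\<^sup>2\<close>, up to rounding. Because the squares of the coordinates have the sum \<open>1\<close>,
  the rounding costs at most \<open>\<epsilon>\<close> in total. With geometric levels in place of all real
  ones, the cuts form a discrete family, and \<open>\<ell>\<^sup>2\<close> coordinates can be attached to them.\<close>

lemma threshold_cuts:
  fixes \<xi> :: "'z \<Rightarrow> 'j \<Rightarrow> real" and \<epsilon> :: real
  assumes nonneg: "\<And>z j. 0 \<le> \<xi> z j"
    and K: "\<And>y z. \<lbrakk>y \<in> S; z \<in> S\<rbrakk> \<Longrightarrow> ((\<lambda>j. \<xi> y j * \<xi> z j) has_sum K y z) UNIV"
    and unit: "\<And>z. z \<in> S \<Longrightarrow> K z z = 1" and \<epsilon>: "0 < \<epsilon>" "\<epsilon> < 1"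
  obtains w :: "'j \<times> int \<Rightarrow> real" and A D
  where "cut_kernel S w A D" "\<And>y z. \<lbrakk>y \<in> S; z \<in> S\<rbrakk> \<Longrightarrow> 1 - K y z - \<epsilon> \<le> D y z"
    "\<And>y z. \<lbrakk>y \<in> S; z \<in> S\<rbrakk> \<Longrightarrow> D y z \<le> (2 - 2 * K y z) / \<epsilon> + 2 * \<epsilon>"
proof -
  define q where "q = 1 / (1 - \<epsilon>)"
  obtain rd where rd: "\<And>x. x \<ge> 0 \<Longrightarrow> ((\<lambda>k. if q powi k \<le> x then \<epsilon> * q powi k else 0) has_sum rd x) UNIV"
    "\<And>x. x \<ge> 0 \<Longrightarrow> rd x \<le> x" "\<And>x. x \<ge> 0 \<Longrightarrow> (1 - \<epsilon>) * x \<le> rd x" "\<And>x y. \<lbrakk>0 \<le> x; x \<le> y\<rbrakk> \<Longrightarrow> rd x \<le> rd y"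
    unfolding q_def using geometric_rounding[OF \<epsilon>] by blast
  have q: "0 < q" using \<epsilon> by (simp add: q_def)
  define w :: "'j \<times> int \<Rightarrow> real" where "w = (\<lambda>(j, k). \<epsilon> * q powi k)"
  define A where "A = (\<lambda>(j, k). {z. q powi k \<le> (\<xi> z j)\<^sup>2})"
  define g where "g y z j = max 0 (rd ((\<xi> y j)\<^sup>2) - rd ((\<xi> z j)\<^sup>2))" for y z j
  define D where "D y z = (\<Sum>\<^sub>\<infinity>j. g y z j)" for y z
  have w: "0 \<le> w i" for i using \<epsilon> q by (auto simp: w_def case_prod_unfold zero_le_power_int)
  have sq: "((\<lambda>j. (\<xi> z j)\<^sup>2) has_sum 1) UNIV" if "z \<in> S" for z
    using K[OF that that] unit[OF that] by (simp add: power2_eq_square)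
  have inner: "((\<lambda>k. if y \<in> A (j, k) \<and> z \<notin> A (j, k) then w (j, k) else 0) has_sum g y z j) UNIV" for y z j
  proof (cases "(\<xi> z j)\<^sup>2 \<le> (\<xi> y j)\<^sup>2")
    case True
    let ?c = "\<lambda>x k. if q powi k \<le> x then \<epsilon> * q powi k else 0"
    have "((\<lambda>k. ?c ((\<xi> y j)\<^sup>2) k + (- 1) * ?c ((\<xi> z j)\<^sup>2) k) has_sum rd ((\<xi> y j)\<^sup>2) + (- 1) * rd ((\<xi> z j)\<^sup>2)) UNIV"
      by (intro has_sum_add has_sum_cmult_right rd(1)) auto
    moreover have "?c ((\<xi> y j)\<^sup>2) k + (- 1) * ?c ((\<xi> z j)\<^sup>2) k
        = (if y \<in> A (j, k) \<and> z \<notin> A (j, k) then w (j, k) else 0)" for k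
      using True by (auto simp: A_def w_def)
    moreover have "g y z j = rd ((\<xi> y j)\<^sup>2) + (- 1) * rd ((\<xi> z j)\<^sup>2)"
      using rd(4)[OF _ True] by (simp add: g_def)
    ultimately show ?thesis by simp
  next
    case False
    then have "(if y \<in> A (j, k) \<and> z \<notin> A (j, k) then w (j, k) else 0) = 0" for k
      by (auto simp: A_def)
    moreover have "g y z j = 0" using rd(4)[of "(\<xi> y j)\<^sup>2" "(\<xi> z j)\<^sup>2"] False by (simp add: g_def)
    ultimately show ?thesis by (simp only: has_sum_0_simp)
  qed
  have g_nonneg: "0 \<le> g y z j" for y z j by (simp add: g_def)
  have rd0: "0 \<le> rd x" if "0 \<le> x" for x
    using rd(3)[OF that] mult_nonneg_nonneg[of "1 - \<epsilon>" x] that \<epsilon> by linarith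
  have g_le: "g y z j \<le> (\<xi> y j)\<^sup>2" for y z j
    using rd(2)[of "(\<xi> y j)\<^sup>2"] rd0[of "(\<xi> z j)\<^sup>2"] by (auto simp: g_def)
  have gD: "((g y z) has_sum D y z) UNIV" if "y \<in> S" "z \<in> S" for y z
    unfolding D_def
    by (intro has_sum_infsum summable_on_comparison_test[OF has_sum_imp_summable[OF sq[OF that(1)]]]
        g_le g_nonneg)
  have "cut_kernel S w A D"
    unfolding cut_kernel_def
  proof (intro conjI allI ballI w)
    fix y z assume yz: "y \<in> S" "z \<in> S"
    show "((\<lambda>i. if y \<in> A i \<and> z \<notin> A i then w i else 0) has_sum D y z) UNIV"
      by (rule has_sum_prod_nonneg[OF inner gD[OF yz]]) (use w in auto)
  qed
  \<comment> \<open>with \<open>a = \<xi> y j\<close> and \<open>b = \<xi> z j\<close>, the positive part of \<open>a\<^sup>2 - b\<^sup>2\<close> is at least \<open>a\<^sup>2 - a * b\<close>\<close>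
  moreover have "1 - K y z - \<epsilon> \<le> D y z" if yz: "y \<in> S" "z \<in> S" for y z
  proof -
    have "((\<lambda>j. (1 - \<epsilon>) * (\<xi> y j)\<^sup>2 + (- 1) * (\<xi> y j * \<xi> z j)) has_sum (1 - \<epsilon>) * 1 + (- 1) * K y z) UNIV"
      by (intro has_sum_add has_sum_cmult_right sq K yz)
    then have "(1 - \<epsilon>) * 1 + (- 1) * K y z \<le> D y z"
    proof (rule has_sum_mono[OF _ gD[OF yz]])
      fix j
      let ?a = "\<xi> y j" and ?b = "\<xi> z j"
      have "(1 - \<epsilon>) * ?a\<^sup>2 \<le> rd (?a\<^sup>2)" "rd (?b\<^sup>2) \<le> ?b\<^sup>2" by (auto intro: rd)
      moreover have "0 \<le> \<epsilon> * ?a\<^sup>2" using \<epsilon> by simp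
      moreover have "?b\<^sup>2 \<le> ?a * ?b" if "?b \<le> ?a"
        using that nonneg[of z j] by (simp add: power2_eq_square mult_right_mono)
      moreover have "?a\<^sup>2 \<le> ?a * ?b" if "?a \<le> ?b"
        using that nonneg[of y j] by (simp add: power2_eq_square mult_left_mono)
      ultimately show "(1 - \<epsilon>) * ?a\<^sup>2 + (- 1) * (?a * ?b) \<le> g y z j"
        by (cases "?b \<le> ?a") (auto simp: g_def left_diff_distrib)
    qed
    then show ?thesis by simp
  qed
  \<comment> \<open>\<open>a\<^sup>2 - b\<^sup>2\<close> is the product of \<open>a - b\<close> and \<open>a + b\<close>; the inequality between the means, weighted by \<open>\<epsilon>\<close>,
     replaces it by squares\<close>
  moreover have "D y z \<le> (2 - 2 * K y z) / \<epsilon> + 2 * \<epsilon>" if yz: "y \<in> S" "z \<in> S" for y z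
  proof -
    have "((\<lambda>j. (1 / \<epsilon>) * (((\<xi> y j)\<^sup>2 + (\<xi> z j)\<^sup>2) + (- 2) * (\<xi> y j * \<xi> z j))
          + ((\<epsilon> / 2) * ((\<xi> y j)\<^sup>2 + (\<xi> z j)\<^sup>2) + \<epsilon> * (\<xi> z j)\<^sup>2))
        has_sum (1 / \<epsilon>) * ((1 + 1) + (- 2) * K y z) + ((\<epsilon> / 2) * (1 + 1) + \<epsilon> * 1)) UNIV"
      by (intro has_sum_add has_sum_cmult_right sq K yz)
    then have "D y z \<le> (1 / \<epsilon>) * ((1 + 1) + (- 2) * K y z) + ((\<epsilon> / 2) * (1 + 1) + \<epsilon> * 1)"
    proof (rule has_sum_mono[OF gD[OF yz]])
      fix j
      let ?a = "\<xi> y j" and ?b = "\<xi> z j"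
      have "rd (?a\<^sup>2) \<le> ?a\<^sup>2" "(1 - \<epsilon>) * ?b\<^sup>2 \<le> rd (?b\<^sup>2)" by (auto intro: rd)
      moreover have "?a\<^sup>2 - ?b\<^sup>2 \<le> (1 / \<epsilon>) * (?a - ?b)\<^sup>2 + (\<epsilon> / 4) * (?a + ?b)\<^sup>2"
      proof -
        have "0 \<le> (1 / \<epsilon>) * ((?a - ?b) - (\<epsilon> / 2) * (?a + ?b))\<^sup>2" using \<epsilon> by simp
        also have "\<dots> = (1 / \<epsilon>) * (?a - ?b)\<^sup>2 + (\<epsilon> / 4) * (?a + ?b)\<^sup>2 - (?a - ?b) * (?a + ?b)"
          using \<epsilon> by (simp add: power2_eq_square field_simps)
        finally show ?thesis by (simp add: power2_eq_square algebra_simps)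
      qed
      moreover have "(\<epsilon> / 4) * (?a + ?b)\<^sup>2 \<le> (\<epsilon> / 4) * (2 * ?a\<^sup>2 + 2 * ?b\<^sup>2)"
        using \<epsilon> by (intro mult_left_mono sum_squares_bound) auto
      moreover have "0 \<le> (1 / \<epsilon>) * (?a - ?b)\<^sup>2" "0 \<le> \<epsilon> * ?a\<^sup>2" "0 \<le> \<epsilon> * ?b\<^sup>2" using \<epsilon> by auto
      moreover have "(1 / \<epsilon>) * (?a - ?b)\<^sup>2 = (1 / \<epsilon>) * ((?a\<^sup>2 + ?b\<^sup>2) + (- 2) * (?a * ?b))"
        by (simp add: power2_eq_square algebra_simps)
      ultimately show "g y z j \<le> (1 / \<epsilon>) * ((?a\<^sup>2 + ?b\<^sup>2) + (- 2) * (?a * ?b))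
          + ((\<epsilon> / 2) * (?a\<^sup>2 + ?b\<^sup>2) + \<epsilon> * ?b\<^sup>2)"
        unfolding g_def by (simp add: algebra_simps)
    qed
    then show ?thesis by (simp add: algebra_simps diff_divide_distrib)
  qed
  ultimately show ?thesis by (rule that)
qed

lemma cut_kernel_sequence:
  assumes "\<And>n. cut_kernel S (w n) (A n) (D n)"
    and "\<And>y z. \<lbrakk>y \<in> S; z \<in> S\<rbrakk> \<Longrightarrow> (\<lambda>n. D n y z) summable_on UNIV"
  shows "cut_kernel S (\<lambda>(n, i). w n i) (\<lambda>(n, i). A n i) (\<lambda>y z. \<Sum>\<^sub>\<infinity>n. D n y z)"
  unfolding cut_kernel_def
proof (intro conjI allI ballI)
  have w: "0 \<le> w n i" for n i using assms(1)[of n] by (simp add: cut_kernel_def)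
  then show "0 \<le> (case ni of (n, i) \<Rightarrow> w n i)" for ni by (simp add: case_prod_unfold)
  fix y z assume yz: "y \<in> S" "z \<in> S"
  show "((\<lambda>ni. if y \<in> (case ni of (n, i) \<Rightarrow> A n i) \<and> z \<notin> (case ni of (n, i) \<Rightarrow> A n i)
      then case ni of (n, i) \<Rightarrow> w n i else 0) has_sum (\<Sum>\<^sub>\<infinity>n. D n y z)) UNIV"
  proof (rule has_sum_prod_nonneg)
    show "((\<lambda>n. D n y z) has_sum (\<Sum>\<^sub>\<infinity>n. D n y z)) UNIV" using assms(2)[OF yz] by simp
    show "((\<lambda>i. if y \<in> (case (n, i) of (n, i) \<Rightarrow> A n i) \<and> z \<notin> (case (n, i) of (n, i) \<Rightarrow> A n i)
        then case (n, i) of (n, i) \<Rightarrow> w n i else 0) has_sum D n y z) UNIV" for n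
      using assms(1)[of n] yz by (simp add: cut_kernel_def cong: if_cong)
  qed (use w in simp)
qed

text \<open>The weight of the cuts at a single scale is bounded, so infinitely many scales are superposed.
  With the precision \<open>\<epsilon> n\<close> and the Gaussian parameter \<open>(\<epsilon> n)\<^sup>2\<close>, the scale \<open>n\<close> contributes at most
  \<open>2 * (M y z + 1) * \<epsilon> n\<close>, which is summable. Once \<open>M y z\<close> is large compared with \<open>1 / (\<epsilon> m)\<^sup>2\<close>, each
  scale below \<open>m\<close> contributes at least \<open>1 / 2\<close>.\<close>

theorem coarse_cut_kernel:
  fixes G :: "'z \<Rightarrow> 'j \<Rightarrow> real"
  assumes G: "sq_dist_kernel S G M" "\<And>z i. 0 \<le> G z i"
    and l2: "\<And>z. z \<in> S \<Longrightarrow> (\<lambda>i. (G z i)\<^sup>2) summable_on UNIV"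
  obtains w :: "nat \<times> 'j list \<times> int \<Rightarrow> real" and A D
  where "cut_kernel S w A D" "\<And>y z. \<lbrakk>y \<in> S; z \<in> S\<rbrakk> \<Longrightarrow> D y z \<le> M y z + 1"
    "\<And>B. \<exists>R. \<forall>y\<in>S. \<forall>z\<in>S. D y z \<le> B \<longrightarrow> M y z \<le> R"
proof -
  define \<epsilon> :: "nat \<Rightarrow> real" where "\<epsilon> n = (1 / 4) * (1 / 2) ^ n" for n
  have \<epsilon>: "0 < \<epsilon> n" "\<epsilon> n \<le> 1 / 4" for n by (simp_all add: \<epsilon>_def power_le_one)
  have M0: "0 \<le> M y z" if "y \<in> S" "z \<in> S" for y z using sq_dist_kernel_nonneg[OF G(1) that] .
  have "\<exists>t :: ('j list \<times> int \<Rightarrow> real) \<times> ('j list \<times> int \<Rightarrow> 'z set) \<times> ('z \<Rightarrow> 'z \<Rightarrow> real).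
      cut_kernel S (fst t) (fst (snd t)) (snd (snd t)) \<and>
      (\<forall>y\<in>S. \<forall>z\<in>S. 3 / 4 - exp (- (\<epsilon> n)\<^sup>2 * M y z) \<le> snd (snd t) y z \<and>
         snd (snd t) y z \<le> 2 * (M y z + 1) * \<epsilon> n)" for n
  proof -
    obtain \<xi> :: "'z \<Rightarrow> 'j list \<Rightarrow> real" where \<xi>: "\<And>a js. 0 \<le> \<xi> a js"
      "\<And>a b. \<lbrakk>a \<in> S; b \<in> S\<rbrakk> \<Longrightarrow> ((\<lambda>js. \<xi> a js * \<xi> b js) has_sum exp (- (\<epsilon> n)\<^sup>2 * M a b)) UNIV"
      using gaussian_unit_vectors[OF G l2, of "(\<epsilon> n)\<^sup>2"] by auto
    obtain w A D where D: "cut_kernel S (w :: 'j list \<times> int \<Rightarrow> real) A D"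
      "\<And>y z. \<lbrakk>y \<in> S; z \<in> S\<rbrakk> \<Longrightarrow> 1 - exp (- (\<epsilon> n)\<^sup>2 * M y z) - \<epsilon> n \<le> D y z"
      "\<And>y z. \<lbrakk>y \<in> S; z \<in> S\<rbrakk> \<Longrightarrow> D y z \<le> (2 - 2 * exp (- (\<epsilon> n)\<^sup>2 * M y z)) / \<epsilon> n + 2 * \<epsilon> n"
    proof (rule threshold_cuts[OF \<xi>, where \<epsilon> = "\<epsilon> n"])
      show "exp (- (\<epsilon> n)\<^sup>2 * M z z) = 1" if "z \<in> S" for z
        using sq_dist_kernel_diag[OF G(1) that] by simp
    qed (use \<epsilon>[of n] in auto)
    have "D y z \<le> 2 * (M y z + 1) * \<epsilon> n" if "y \<in> S" "z \<in> S" for y z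
    proof -
      have "1 - (\<epsilon> n)\<^sup>2 * M y z \<le> exp (- (\<epsilon> n)\<^sup>2 * M y z)"
        using exp_ge_add_one_self[of "- (\<epsilon> n)\<^sup>2 * M y z"] by simp
      then have "(2 - 2 * exp (- (\<epsilon> n)\<^sup>2 * M y z)) / \<epsilon> n \<le> (2 * (\<epsilon> n)\<^sup>2 * M y z) / \<epsilon> n"
        using \<epsilon>(1)[of n] by (intro divide_right_mono) auto
      also have "\<dots> = 2 * \<epsilon> n * M y z" using \<epsilon>(1)[of n] by (simp add: power2_eq_square)
      finally show ?thesis using D(3)[OF that] by (simp add: algebra_simps)
    qed
    moreover have "3 / 4 - exp (- (\<epsilon> n)\<^sup>2 * M y z) \<le> D y z" if "y \<in> S" "z \<in> S" for y z
      using D(2)[OF that] \<epsilon>(2)[of n] by simp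
    ultimately show ?thesis using D(1) by (intro exI[of _ "(w, A, D)"]) simp
  qed
  then obtain t :: "nat \<Rightarrow> ('j list \<times> int \<Rightarrow> real) \<times> ('j list \<times> int \<Rightarrow> 'z set) \<times> ('z \<Rightarrow> 'z \<Rightarrow> real)"
    where t: "\<And>n. cut_kernel S (fst (t n)) (fst (snd (t n))) (snd (snd (t n))) \<and>
      (\<forall>y\<in>S. \<forall>z\<in>S. 3 / 4 - exp (- (\<epsilon> n)\<^sup>2 * M y z) \<le> snd (snd (t n)) y z \<and>
         snd (snd (t n)) y z \<le> 2 * (M y z + 1) * \<epsilon> n)"
    by metis
  define w A D where "w n = fst (t n)" and "A n = fst (snd (t n))" and "D n = snd (snd (t n))" for n
  have cut: "cut_kernel S (w n) (A n) (D n)" for n using t by (simp add: w_def A_def D_def)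
  have D_ge: "3 / 4 - exp (- (\<epsilon> n)\<^sup>2 * M y z) \<le> D n y z" and D_le: "D n y z \<le> 2 * (M y z + 1) * \<epsilon> n"
    if "y \<in> S" "z \<in> S" for n y z using t that by (simp_all add: D_def)
  have D0: "0 \<le> D n y z" if "y \<in> S" "z \<in> S" for n y z using cut_kernel_nonneg[OF cut that] .
  have sum_\<epsilon>: "((\<lambda>n. 2 * (M y z + 1) * \<epsilon> n) has_sum M y z + 1) UNIV" if "y \<in> S" "z \<in> S" for y z
  proof -
    have "((\<lambda>n. (1 / 2 :: real) ^ n) has_sum 1 / (1 - 1 / 2)) UNIV"
      by (intro sums_nonneg_imp_has_sum geometric_sums) auto
    then have "((\<lambda>n. (M y z + 1) / 2 * (1 / 2 :: real) ^ n) has_sum (M y z + 1) / 2 * (1 / (1 - 1 / 2))) UNIV"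
      by (rule has_sum_cmult_right)
    moreover have "(M y z + 1) / 2 * (1 / 2 :: real) ^ n = 2 * (M y z + 1) * \<epsilon> n" for n
      by (simp add: \<epsilon>_def)
    moreover have "(M y z + 1) / 2 * (1 / (1 - 1 / 2)) = M y z + 1" by simp
    ultimately show ?thesis by (simp only:)
  qed
  have sumD: "(\<lambda>n. D n y z) summable_on UNIV" if "y \<in> S" "z \<in> S" for y z
    by (rule summable_on_comparison_test[OF has_sum_imp_summable[OF sum_\<epsilon>[OF that]]])
      (rule D_le[OF that] D0[OF that])+
  let ?D = "\<lambda>y z. \<Sum>\<^sub>\<infinity>n. D n y z"
  have 1: "cut_kernel S (\<lambda>(n, i). w n i) (\<lambda>(n, i). A n i) ?D"
    by (rule cut_kernel_sequence[OF cut sumD])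
  have 2: "?D y z \<le> M y z + 1" if "y \<in> S" "z \<in> S" for y z
    by (rule has_sum_mono[OF has_sum_infsum[OF sumD[OF that]] sum_\<epsilon>[OF that]]) (rule D_le[OF that])
  have 3: "\<exists>R. \<forall>y\<in>S. \<forall>z\<in>S. ?D y z \<le> B \<longrightarrow> M y z \<le> R" for B
  proof -
    obtain m :: nat where m: "2 * B < real m" using reals_Archimedean2 by blast
    have "M y z \<le> 3 / (\<epsilon> m)\<^sup>2" if yz: "y \<in> S" "z \<in> S" and le: "?D y z \<le> B" for y z
    proof (rule ccontr)
      assume "\<not> ?thesis"
      then have far: "3 < (\<epsilon> m)\<^sup>2 * M y z" using \<epsilon>(1)[of m] by (simp add: field_simps)
      have "1 / 2 \<le> D n y z" if n: "n < m" for n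
      proof -
        have "\<epsilon> m \<le> \<epsilon> n" using n by (simp add: \<epsilon>_def power_decreasing)
        then have "(\<epsilon> m)\<^sup>2 * M y z \<le> (\<epsilon> n)\<^sup>2 * M y z"
          using \<epsilon>(1)[of m] M0[OF yz] by (intro mult_right_mono power_mono) auto
        then have "4 \<le> exp ((\<epsilon> n)\<^sup>2 * M y z)" using far exp_ge_add_one_self[of "(\<epsilon> n)\<^sup>2 * M y z"] by linarith
        then have "exp (- (\<epsilon> n)\<^sup>2 * M y z) \<le> 1 / 4"
          using le_imp_inverse_le[of 4 "exp ((\<epsilon> n)\<^sup>2 * M y z)"] by (simp add: exp_minus)
        then show ?thesis using D_ge[OF yz, of n] by simp
      qed
      then have "(\<Sum>n<m. 1 / 2) \<le> (\<Sum>n<m. D n y z)" by (intro sum_mono) simp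
      also have "\<dots> \<le> ?D y z" using D0 yz by (intro finite_sum_le_infsum sumD) auto
      finally show False using le m by simp
    qed
    then show ?thesis by blast
  qed
  show ?thesis by (rule that[OF 1 2 3])
qed

section \<open>Kernels on the wreath product\<close>

text \<open>The squared \<open>\<ell>\<^sup>2\<close> distance between two point masses of size \<open>c\<close>, each of them possibly absent.\<close>

lemma has_sum_point_masses:
  fixes c :: real
  shows "((\<lambda>u. ((if P \<and> u = r then c else 0) - (if P' \<and> u = r' then c else 0))\<^sup>2) has_sum
     (if P \<and> P' then (if r = r' then 0 else 2 * c\<^sup>2) else if P \<or> P' then c\<^sup>2 else 0)) UNIV"
  by (rule has_sum_finite_neutralI[where B = "{r, r'}"]) auto

lemma discrete_kernel:
  "sq_dist_kernel S (\<lambda>x u. if u = x then 1 else 0) (\<lambda>x x'. if x = x' then 0 else 2)"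
  unfolding sq_dist_kernel_def
proof (intro ballI)
  fix x x' :: 'a
  show "((\<lambda>u. ((if u = x then 1 else 0 :: real) - (if u = x' then 1 else 0))\<^sup>2)
      has_sum (if x = x' then 0 else 2)) UNIV"
    using has_sum_point_masses[of True x 1 True x'] by (cases "x = x'") auto
qed

lemma supp_diff_subset_mspace: "supp_diff Z f g \<subseteq> mspace Z"
  by (auto simp: supp_diff_def)

text \<open>Only the finitely many lamps that differ contribute to the sum over all of \<open>Z\<close>.\<close>

lemma lampwise_kernel:
  assumes F: "sq_dist_kernel (mspace X) F N"
  shows "sq_dist_kernel (wreath_space x0 X Y Z)
    (\<lambda>(f, y) (z, i). if z \<in> mspace Z then F (f z) i else 0)
    (\<lambda>(f, y) (g, y'). \<Sum>z\<in>supp_diff Z f g. N (f z) (g z))"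
  unfolding sq_dist_kernel_def
proof (intro ballI)
  fix a b assume "a \<in> wreath_space x0 X Y Z" "b \<in> wreath_space x0 X Y Z"
  moreover obtain f y g y' where ab: "a = (f, y)" "b = (g, y')" by (cases a; cases b)
  ultimately have W: "(f, y) \<in> wreath_space x0 X Y Z" "(g, y') \<in> wreath_space x0 X Y Z" by simp_all
  have X: "f z \<in> mspace X" "g z \<in> mspace X" if "z \<in> mspace Z" for z
    using W that by (auto simp: wreath_space_def)
  let ?c = "\<lambda>z. if z \<in> mspace Z then N (f z) (g z) else 0"
  have "(?c has_sum (\<Sum>z\<in>supp_diff Z f g. N (f z) (g z))) UNIV"
  proof (rule has_sum_finite_neutralI[OF finite_supp_diff[OF W]])
    show "?c z = 0" if "z \<in> UNIV - supp_diff Z f g" for z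
      using that X sq_dist_kernel_diag[OF F] by (auto simp: supp_diff_def)
    show "(\<Sum>z\<in>supp_diff Z f g. N (f z) (g z)) = (\<Sum>z\<in>supp_diff Z f g. ?c z)"
      using supp_diff_subset_mspace[of Z f g] by (intro sum.cong) auto
  qed simp
  then have "((\<lambda>zi. ((\<lambda>(z, i). if z \<in> mspace Z then F (f z) i else 0) zi -
        (\<lambda>(z, i). if z \<in> mspace Z then F (g z) i else 0) zi)\<^sup>2)
      has_sum (\<Sum>z\<in>supp_diff Z f g. N (f z) (g z))) UNIV"
    by (rule has_sum_prod_nonneg[rotated]) (use F X in \<open>auto simp: sq_dist_kernel_def\<close>)
  then show "((\<lambda>i. ((case a of (f, y) \<Rightarrow> \<lambda>(z, i). if z \<in> mspace Z then F (f z) i else 0) i -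
      (case b of (f, y) \<Rightarrow> \<lambda>(z, i). if z \<in> mspace Z then F (f z) i else 0) i)\<^sup>2) has_sum
      (case a of (f, y) \<Rightarrow> \<lambda>(g, y'). \<Sum>z\<in>supp_diff Z f g. N (f z) (g z)) b) UNIV"
    by (simp add: ab)
qed

lemma has_sum_finite_sum:
  fixes f :: "'a \<Rightarrow> 'i \<Rightarrow> real"
  assumes "finite B" "\<And>z. z \<in> B \<Longrightarrow> (f z has_sum s z) UNIV"
  shows "((\<lambda>i. \<Sum>z\<in>B. f z i) has_sum (\<Sum>z\<in>B. s z)) UNIV"
  using assms by (induction B rule: finite_induct) (auto intro: has_sum_add)

text \<open>The vector of \<open>(f, y)\<close> remembers, for every cut containing the
  position of \<open>y\<close>, the lamps outside that cut. If a cut contains both positions, the vectors differ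
  there exactly if the cut omits a point where the lamps differ; if it contains just one of them, they
  always differ. The lower bound uses that a cut containing \<open>p y\<close> and omitting \<open>z\<close> falls under one of
  these two cases.\<close>

lemma lamp_kernel:
  fixes X :: "'x metric" and Y :: "'y metric" and Z :: "'z metric" and w :: "'i \<Rightarrow> real"
  assumes cut: "cut_kernel (mspace Z) w A D" and p: "p \<in> mspace Y \<rightarrow> mspace Z"
  obtains G :: "('z \<Rightarrow> 'x) \<times> 'y \<Rightarrow> 'i \<times> ('z \<Rightarrow> 'x) \<Rightarrow> real" and N
  where "sq_dist_kernel (wreath_space x0 X Y Z) G N"
    "\<And>f y g y' z. \<lbrakk>(f, y) \<in> wreath_space x0 X Y Z; (g, y') \<in> wreath_space x0 X Y Z; z \<in> supp_diff Z f g\<rbrakk>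
       \<Longrightarrow> D (p y) z \<le> N (f, y) (g, y')"
    "\<And>f y g y'. \<lbrakk>(f, y) \<in> wreath_space x0 X Y Z; (g, y') \<in> wreath_space x0 X Y Z\<rbrakk>
       \<Longrightarrow> N (f, y) (g, y') \<le> D (p y) (p y') + D (p y') (p y) + 2 * (\<Sum>z\<in>supp_diff Z f g. D (p y) z)"
proof -
  let ?W = "wreath_space x0 X Y Z"
  define G :: "('z \<Rightarrow> 'x) \<times> 'y \<Rightarrow> 'i \<times> ('z \<Rightarrow> 'x) \<Rightarrow> real" where
    "G = (\<lambda>(f, y) (i, u). if p y \<in> A i \<and> u = restrict f (- A i) then sqrt (w i) else 0)"
  define c :: "('z \<Rightarrow> 'x) \<times> 'y \<Rightarrow> ('z \<Rightarrow> 'x) \<times> 'y \<Rightarrow> 'i \<Rightarrow> real" where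
    "c = (\<lambda>(f, y) (g, y') i. if p y \<in> A i \<and> p y' \<in> A i then (if supp_diff Z f g \<subseteq> A i then 0 else 2 * w i)
      else if p y \<in> A i \<or> p y' \<in> A i then w i else 0)"
  define N where "N a b = (\<Sum>\<^sub>\<infinity>i. c a b i)" for a b
  let ?e = "\<lambda>y z i. if y \<in> A i \<and> z \<notin> A i then w i else 0"
  have w: "0 \<le> w i" for i using cut by (simp add: cut_kernel_def)
  have D: "(?e y z has_sum D y z) UNIV" if "y \<in> mspace Z" "z \<in> mspace Z" for y z
    using cut that by (simp add: cut_kernel_def)
  have c0: "0 \<le> c a b i" for a b i using w by (auto simp: c_def case_prod_unfold)
  have bound: "((\<lambda>i. (?e (p y) (p y') i + ?e (p y') (p y) i) + 2 * (\<Sum>z\<in>supp_diff Z f g. ?e (p y) z i))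
        has_sum D (p y) (p y') + D (p y') (p y) + 2 * (\<Sum>z\<in>supp_diff Z f g. D (p y) z)) UNIV"
    and c_le: "c (f, y) (g, y') i \<le> (?e (p y) (p y') i + ?e (p y') (p y) i) + 2 * (\<Sum>z\<in>supp_diff Z f g. ?e (p y) z i)"
    if W: "(f, y) \<in> ?W" "(g, y') \<in> ?W" for f y g y' i
  proof -
    have py: "p y \<in> mspace Z" "p y' \<in> mspace Z" using W p by (auto simp: wreath_space_def)
    have fin: "finite (supp_diff Z f g)" by (rule finite_supp_diff[OF W])
    show "((\<lambda>i. (?e (p y) (p y') i + ?e (p y') (p y) i) + 2 * (\<Sum>z\<in>supp_diff Z f g. ?e (p y) z i))
        has_sum D (p y) (p y') + D (p y') (p y) + 2 * (\<Sum>z\<in>supp_diff Z f g. D (p y) z)) UNIV"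
      using py supp_diff_subset_mspace[of Z f g]
      by (intro has_sum_add has_sum_cmult_right has_sum_finite_sum fin D) auto
    have nonneg: "0 \<le> (\<Sum>z\<in>supp_diff Z f g. ?e (p y) z i)" using w by (intro sum_nonneg) auto
    have "w i \<le> (\<Sum>z\<in>supp_diff Z f g. ?e (p y) z i)" if out: "p y \<in> A i" "\<not> supp_diff Z f g \<subseteq> A i"
    proof -
      obtain z where z: "z \<in> supp_diff Z f g" "z \<notin> A i" using out by blast
      then have "?e (p y) z i \<le> (\<Sum>z\<in>supp_diff Z f g. ?e (p y) z i)"
        using w fin by (intro member_le_sum) auto
      then show ?thesis using z out by simp
    qed
    then show "c (f, y) (g, y') i \<le> (?e (p y) (p y') i + ?e (p y') (p y) i) + 2 * (\<Sum>z\<in>supp_diff Z f g. ?e (p y) z i)"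
      using nonneg w[of i] by (auto simp: c_def)
  qed
  have cN: "(c a b has_sum N a b) UNIV" if "a \<in> ?W" "b \<in> ?W" for a b
  proof -
    obtain f y g y' where ab: "a = (f, y)" "b = (g, y')" by (cases a; cases b)
    then have W: "(f, y) \<in> ?W" "(g, y') \<in> ?W" using that by simp_all
    have "c (f, y) (g, y') summable_on UNIV"
      by (rule summable_on_comparison_test[OF has_sum_imp_summable[OF bound[OF W]]])
        (rule c_le[OF W] c0)+
    then show ?thesis unfolding N_def ab by (rule has_sum_infsum)
  qed
  have "sq_dist_kernel ?W G N"
    unfolding sq_dist_kernel_def
  proof (intro ballI)
    fix a b assume ab: "a \<in> ?W" "b \<in> ?W"
    obtain f y g y' where eq: "a = (f, y)" "b = (g, y')" by (cases a; cases b)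
    have same: "restrict f (- A i) = restrict g (- A i) \<longleftrightarrow> supp_diff Z f g \<subseteq> A i" for i
    proof -
      have "f z = g z" if "z \<notin> mspace Z" for z
        using ab eq that by (auto simp: wreath_space_def PiE_arb[of f] PiE_arb[of g])
      then show ?thesis by (auto simp: supp_diff_def restrict_def fun_eq_iff)
    qed
    have c_eq: "c (f, y) (g, y') i = (if p y \<in> A i \<and> p y' \<in> A i
        then (if restrict f (- A i) = restrict g (- A i) then 0 else 2 * (sqrt (w i))\<^sup>2)
        else if p y \<in> A i \<or> p y' \<in> A i then (sqrt (w i))\<^sup>2 else 0)" for i
      using w by (simp add: c_def same)
    have "((\<lambda>u. (G a (i, u) - G b (i, u))\<^sup>2) has_sum c a b i) UNIV" for i
      unfolding c_eq eq G_def prod.case by (rule has_sum_point_masses)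
    then show "((\<lambda>i. (G a i - G b i)\<^sup>2) has_sum N a b) UNIV"
      by (rule has_sum_prod_nonneg[OF _ cN[OF ab]]) simp
  qed
  moreover have "D (p y) z \<le> N (f, y) (g, y')"
    if W: "(f, y) \<in> ?W" "(g, y') \<in> ?W" and z: "z \<in> supp_diff Z f g" for f y g y' z
  proof (rule has_sum_mono[OF D cN[OF W]])
    show "p y \<in> mspace Z" "z \<in> mspace Z" using W p z by (auto simp: wreath_space_def supp_diff_def)
    show "?e (p y) z i \<le> c (f, y) (g, y') i" for i using z w[of i] by (auto simp: c_def)
  qed
  moreover have "N (f, y) (g, y') \<le> D (p y) (p y') + D (p y') (p y) + 2 * (\<Sum>z\<in>supp_diff Z f g. D (p y) z)"
    if W: "(f, y) \<in> ?W" "(g, y') \<in> ?W" for f y g y'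
    by (rule has_sum_mono[OF cN[OF W] bound[OF W]]) (rule c_le[OF W])
  ultimately show ?thesis by (rule that)
qed

section \<open>Paths visiting a finite set\<close>

lemma mdist_le_path_length:
  assumes "y \<in> mspace Y" "y' \<in> mspace Y" "set ws \<subseteq> mspace Y" "w \<in> insert y' (set ws)"
  shows "mdist Y y w \<le> path_length Y y ws y'"
  using assms
proof (induction ws arbitrary: y)
  case (Cons v ws)
  have v: "v \<in> mspace Y" "set ws \<subseteq> mspace Y" using Cons.prems by auto
  show ?case
  proof (cases "w = v")
    case True
    then show ?thesis using path_length_nonneg by simp
  next
    case False
    then have w: "w \<in> insert y' (set ws)" using Cons.prems by auto
    then have "w \<in> mspace Y" using Cons.prems by auto
    then have "mdist Y y w \<le> mdist Y y v + mdist Y v w"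
      using Cons.prems v by (intro mdist_triangle) auto
    then show ?thesis using Cons.IH[OF v(1) Cons.prems(2) v(2) w] by simp
  qed
qed simp

lemma path_length_ge_card:
  assumes sep: "\<And>a b. \<lbrakk>a \<in> mspace Y; b \<in> mspace Y; a \<noteq> b\<rbrakk> \<Longrightarrow> \<delta> \<le> mdist Y a b" and "0 \<le> \<delta>"
    and "y \<in> mspace Y" "set ws \<subseteq> mspace Y"
  shows "\<delta> * card (set ws - {y}) \<le> path_length Y y ws y'"
  using assms(3,4)
proof (induction ws arbitrary: y)
  case (Cons v ws)
  have IH: "\<delta> * card (set ws - {v}) \<le> path_length Y v ws y'" using Cons by simp
  show ?case
  proof (cases "v = y")
    case True
    then have eq: "set (v # ws) - {y} = set ws - {v}" by auto
    show ?thesis unfolding eq path_length.simps by (rule add_increasing[OF mdist_nonneg IH])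
  next
    case False
    have "card (set (v # ws) - {y}) \<le> card (insert v (set ws - {v}))"
      by (intro card_mono) auto
    also have "\<dots> = Suc (card (set ws - {v}))" by (rule card.insert) auto
    finally have "card (set (v # ws) - {y}) \<le> Suc (card (set ws - {v}))" .
    then have "\<delta> * card (set (v # ws) - {y}) \<le> \<delta> * Suc (card (set ws - {v}))"
      using \<open>0 \<le> \<delta>\<close> by (intro mult_left_mono) auto
    moreover have "\<delta> \<le> mdist Y y v" using False Cons.prems by (intro sep) auto
    ultimately show ?thesis using IH by (simp add: algebra_simps)
  qed
qed simp

text \<open>A short path passes through few points, because distinct points of \<open>Y\<close> are uniformly
  separated; and each of them serves only boundedly many points of the set to be visited.\<close>

lemma visited_set_bounds:
  assumes p: "dense_map C Y Z p" and born: "bornologous Y Z p" and disc: "uniformly_discrete Y"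
    and geom: "bounded_geometry C Z" and R: "0 \<le> R"
  obtains n :: nat and T :: real
  where "\<And>I y y'. \<lbrakk>finite I; I \<subseteq> mspace Z; y \<in> mspace Y; y' \<in> mspace Y; visiting_path C p Y Z I y y' \<le> R\<rbrakk>
    \<Longrightarrow> card I \<le> n \<and> (\<forall>z\<in>I. mdist Z (p y) z \<le> T) \<and> mdist Y y y' \<le> R + 1"
proof -
  obtain \<delta> where \<delta>: "\<delta> > 0" "\<And>x. x \<in> mspace Y \<Longrightarrow> mcball_of Y x \<delta> = {x}"
    using disc by (auto simp: uniformly_discrete_def)
  obtain N :: nat where N: "\<And>z. z \<in> mspace Z \<Longrightarrow> finite (mcball_of Z z C) \<and> card (mcball_of Z z C) \<le> N"
    using geom by (auto simp: bounded_geometry_def)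
  have "R + 1 > 0" using R by simp
  then obtain S where S: "\<And>y y'. \<lbrakk>y \<in> mspace Y; y' \<in> mspace Y; mdist Y y y' \<le> R + 1\<rbrakk> \<Longrightarrow> mdist Z (p y) (p y') \<le> S"
    using born unfolding bornologous_def by metis
  have pZ: "p y \<in> mspace Z" if "y \<in> mspace Y" for y using p that by (auto simp: dense_map_def)
  have sep: "\<delta> \<le> mdist Y a b" if "a \<in> mspace Y" "b \<in> mspace Y" "a \<noteq> b" for a b
  proof (rule ccontr)
    assume "\<not> \<delta> \<le> mdist Y a b"
    then have "b \<in> mcball_of Y a \<delta>" using that by simp
    then show False using \<delta>(2)[OF that(1)] that by simp
  qed
  define k where "k = nat \<lceil>(R + 1) / \<delta>\<rceil> + 1"
  have "card I \<le> k * N \<and> (\<forall>z\<in>I. mdist Z (p y) z \<le> S + C) \<and> mdist Y y y' \<le> R + 1"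
    if I: "finite I" "I \<subseteq> mspace Z" and y: "y \<in> mspace Y" "y' \<in> mspace Y"
      and le: "visiting_path C p Y Z I y y' \<le> R" for I y y'
  proof -
    have "(INF ys\<in>visiting_tuples C p Y Z I. path_length Y y ys y') < R + 1"
      using le by (simp add: visiting_path_def)
    then obtain ys where ys: "ys \<in> visiting_tuples C p Y Z I" "path_length Y y ys y' < R + 1"
      using visiting_tuples_nonempty[OF p I]
      by (subst (asm) cINF_less_iff) (auto intro!: bdd_belowI2[of _ 0] path_length_nonneg)
    from ys(1) obtain zs where zs: "set ys \<subseteq> mspace Y" "set zs = I"
        "list_all2 (\<lambda>y z. p y \<in> mcball_of Z z C) ys zs"
      by (auto simp: visiting_tuples_def)
    have near: "\<exists>v\<in>set ys. mdist Z (p v) z \<le> C" if z: "z \<in> I" for z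
    proof -
      obtain i where i: "i < length zs" "zs ! i = z" using z zs(2) by (auto simp: in_set_conv_nth)
      then have "p (ys ! i) \<in> mcball_of Z z C" "ys ! i \<in> set ys"
        using zs(3) by (auto simp: list_all2_conv_all_nth simp del: in_mcball_of)
      then show ?thesis by (auto simp: mdist_commute)
    qed
    have dist: "mdist Y y v \<le> R + 1" if "v \<in> insert y' (set ys)" for v
      using mdist_le_path_length[OF y zs(1) that] ys(2) by simp
    have "mdist Z (p y) z \<le> S + C" if z: "z \<in> I" for z
    proof -
      obtain v where v: "v \<in> set ys" "mdist Z (p v) z \<le> C" using near[OF z] by blast
      then have vY: "v \<in> mspace Y" using zs(1) by auto
      have "mdist Z (p y) z \<le> mdist Z (p y) (p v) + mdist Z (p v) z"
        using y vY z I pZ by (intro mdist_triangle) auto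
      moreover have "mdist Z (p y) (p v) \<le> S" using v by (intro S y vY dist) auto
      ultimately show ?thesis using v(2) by simp
    qed
    moreover have "card I \<le> k * N"
    proof -
      have "\<delta> * card (set ys - {y}) \<le> path_length Y y ys y'"
        using \<delta>(1) by (intro path_length_ge_card sep y zs(1)) auto
      then have "real (card (set ys - {y})) \<le> (R + 1) / \<delta>" using ys(2) \<delta>(1) by (simp add: field_simps)
      then have "card (set ys - {y}) \<le> nat \<lceil>(R + 1) / \<delta>\<rceil>" by linarith
      moreover have "card (set ys) \<le> Suc (card (set ys - {y}))"
        by (cases "y \<in> set ys") (simp_all add: card_Diff_singleton)
      ultimately have k: "card (set ys) \<le> k" by (simp add: k_def)
      have "I \<subseteq> (\<Union>v\<in>set ys. mcball_of Z (p v) C)"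
      proof
        fix z assume z: "z \<in> I"
        then obtain v where v: "v \<in> set ys" "mdist Z (p v) z \<le> C" using near by blast
        then have "z \<in> mcball_of Z (p v) C" using z I pZ zs(1) by auto
        then show "z \<in> (\<Union>v\<in>set ys. mcball_of Z (p v) C)" using v by blast
      qed
      then have "card I \<le> card (\<Union>v\<in>set ys. mcball_of Z (p v) C)"
        using N pZ zs(1) by (intro card_mono finite_UN_I) auto
      also have "\<dots> \<le> (\<Sum>v\<in>set ys. card (mcball_of Z (p v) C))" by (intro card_UN_le) simp
      also have "\<dots> \<le> (\<Sum>v\<in>set ys. N)" using N pZ zs(1) by (intro sum_mono) auto
      also have "\<dots> \<le> k * N" using k by simp
      finally show ?thesis .
    qed
    ultimately show ?thesis using dist[of y'] by simp
  qed
  then show ?thesis by (rule that)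
qed

lemma path_length_star:
  assumes y: "y \<in> mspace Y" "y' \<in> mspace Y" and r: "0 \<le> r"
    and "u \<in> mspace Y" "set ws \<subseteq> mspace Y" "\<forall>w\<in>set ws. mdist Y y w \<le> r"
  shows "path_length Y u ws y' \<le> mdist Y y u + 2 * r * length ws + mdist Y y y'"
  using assms(4-)
proof (induction ws arbitrary: u)
  case Nil
  then show ?case using mdist_triangle[of u Y y y'] y by (simp add: mdist_commute)
next
  case (Cons w ws)
  have "mdist Y u w \<le> mdist Y u y + mdist Y y w" using Cons.prems y by (intro mdist_triangle) auto
  moreover have "path_length Y w ws y' \<le> mdist Y y w + 2 * r * length ws + mdist Y y y'"
    using Cons by simp
  ultimately show ?case using Cons.prems by (simp add: algebra_simps mdist_commute)
qed

text \<open>The lifting property yields a point within \<open>\<theta> T\<close> of \<open>y\<close> for each \<open>z\<close>; a path may return to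
  \<open>y\<close> after each visit.\<close>

lemma visiting_path_star:
  assumes lift: "\<And>z z' y. \<lbrakk>z \<in> mspace Z; z' \<in> mspace Z; y \<in> mspace Y; mdist Z (p y) z \<le> C\<rbrakk> \<Longrightarrow>
        \<exists>y'\<in>mspace Y. mdist Z (p y') z' \<le> C \<and> mdist Y y y' \<le> \<theta> (mdist Z z z')"
    and \<theta>: "\<theta> \<in> {0..} \<rightarrow> {0..}" "mono_on {0..} \<theta>" and C: "0 \<le> C" and p: "p \<in> mspace Y \<rightarrow> mspace Z"
    and I: "finite I" "I \<subseteq> mspace Z" and y: "y \<in> mspace Y" "y' \<in> mspace Y"
    and T: "0 \<le> T" "\<And>z. z \<in> I \<Longrightarrow> mdist Z (p y) z \<le> T"
  shows "visiting_path C p Y Z I y y' \<le> 2 * \<theta> T * card I + mdist Y y y'"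
proof -
  have \<theta>T: "0 \<le> \<theta> T" using \<theta>(1) T(1) by auto
  have py: "p y \<in> mspace Z" using p y by auto
  then have 0: "mdist Z (p y) (p y) = 0" by simp
  have "\<exists>v. v \<in> mspace Y \<and> mdist Z (p v) z \<le> C \<and> mdist Y y v \<le> \<theta> T" if z: "z \<in> I" for z
  proof -
    have "\<exists>v\<in>mspace Y. mdist Z (p v) z \<le> C \<and> mdist Y y v \<le> \<theta> (mdist Z (p y) z)"
      using z I y C 0 by (intro lift py) auto
    moreover have "\<theta> (mdist Z (p y) z) \<le> \<theta> T" using T z by (intro mono_onD[OF \<theta>(2)]) auto
    ultimately show ?thesis by (blast intro: order_trans)
  qed
  then obtain q where q: "\<And>z. z \<in> I \<Longrightarrow> q z \<in> mspace Y \<and> mdist Z (p (q z)) z \<le> C \<and> mdist Y y (q z) \<le> \<theta> T"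
    by metis
  obtain zs where zs: "set zs = I" "distinct zs" using finite_distinct_list[OF I(1)] by blast
  have "p (q z) \<in> mcball_of Z z C" if "z \<in> I" for z
    using q[OF that] that I p by (auto simp: mdist_commute)
  then have "map q zs \<in> visiting_tuples C p Y Z I"
    using zs q unfolding visiting_tuples_def
    by (auto intro!: exI[of _ zs] simp: list_all2_map1 list_all2_same simp del: in_mcball_of)
  then have "visiting_path C p Y Z I y y' \<le> path_length Y y (map q zs) y'" by (rule visiting_path_le)
  also have "path_length Y y (map q zs) y' \<le> mdist Y y y + 2 * \<theta> T * length (map q zs) + mdist Y y y'"
    using q zs y \<theta>T by (intro path_length_star) auto
  finally have "visiting_path C p Y Z I y y' \<le> mdist Y y y + 2 * \<theta> T * length (map q zs) + mdist Y y y'" .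
  moreover have "mdist Y y y = 0" using y by simp
  ultimately show ?thesis using zs distinct_card[OF zs(2)] by simp
qed

section \<open>Coarse embeddability of the wreath product\<close>

theorem theorem1p4:
  fixes X :: "'x metric" and Y :: "'y metric" and Z :: "'z metric"
    and x0 :: 'x and C :: real and p :: "'y \<Rightarrow> 'z"
  assumes "x0 \<in> mspace X"
    and "C \<ge> 0"
    and "dense_map C Y Z p"
    and "bornologous Y Z p"
    and "coarse_path_lifting C Y Z p"
    and "uniformly_discrete Y"
    and "bounded_geometry C Z"
    and "hilbert_coarsely_embeddable X"
    and "hilbert_coarsely_embeddable Y"
    and "hilbert_coarsely_embeddable Z"
  shows "hilbert_coarsely_embeddable (metric_wreath C p x0 X Y Z)"
proof -
  note p = assms(3)
  let ?W = "wreath_space x0 X Y Z" and ?d = "mdist (metric_wreath C p x0 X Y Z)"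
  have pZ: "p \<in> mspace Y \<rightarrow> mspace Z" using p by (simp add: dense_map_def)
  obtain \<theta> where \<theta>: "\<theta> \<in> {0..} \<rightarrow> {0..}" "mono_on {0..} \<theta>"
    and lift: "\<And>z z' y. \<lbrakk>z \<in> mspace Z; z' \<in> mspace Z; y \<in> mspace Y; mdist Z (p y) z \<le> C\<rbrakk> \<Longrightarrow>
        \<exists>y'\<in>mspace Y. mdist Z (p y') z' \<le> C \<and> mdist Y y y' \<le> \<theta> (mdist Z z z')"
    using assms(5) unfolding coarse_path_lifting_def by metis
  obtain FX :: "'x \<Rightarrow> ('x \<Rightarrow> real) \<Rightarrow> real" and NX
    where FX: "sq_dist_kernel (mspace X) FX NX" and NX: "coarse_kernel X NX"
    using hilbert_coarsely_embeddable_coordinates[OF assms(8)] by metis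
  obtain FY :: "'y \<Rightarrow> ('y \<Rightarrow> real) \<Rightarrow> real" and NY
    where FY: "sq_dist_kernel (mspace Y) FY NY" and NY: "coarse_kernel Y NY"
    using hilbert_coarsely_embeddable_coordinates[OF assms(9)] by metis
  obtain FZ :: "'z \<Rightarrow> ('z \<Rightarrow> real) \<Rightarrow> real" and NZ
    where FZ: "sq_dist_kernel (mspace Z) FZ NZ" "coarse_kernel Z NZ"
      "\<And>a. a \<in> mspace Z \<Longrightarrow> (\<lambda>i. (FZ a i)\<^sup>2) summable_on UNIV"
    using hilbert_coarsely_embeddable_coordinates[OF assms(10)] by metis
  obtain GZ :: "'z \<Rightarrow> ('z \<Rightarrow> real) \<times> bool \<Rightarrow> real" and MZ
    where GZ: "sq_dist_kernel (mspace Z) GZ MZ" and MZ: "coarse_kernel Z MZ"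
      and GZ_nonneg: "\<And>a i. 0 \<le> GZ a i"
      and GZ_l2: "\<And>a. a \<in> mspace Z \<Longrightarrow> (\<lambda>i. (GZ a i)\<^sup>2) summable_on UNIV"
    using nonneg_coordinates[OF FZ] by metis
  obtain w :: "nat \<times> (('z \<Rightarrow> real) \<times> bool) list \<times> int \<Rightarrow> real" and A D
    where cut: "cut_kernel (mspace Z) w A D"
      and D_le: "\<And>y z. \<lbrakk>y \<in> mspace Z; z \<in> mspace Z\<rbrakk> \<Longrightarrow> D y z \<le> MZ y z + 1"
      and D_ge: "\<And>B. \<exists>R. \<forall>y\<in>mspace Z. \<forall>z\<in>mspace Z. D y z \<le> B \<longrightarrow> MZ y z \<le> R"
    using coarse_cut_kernel[OF GZ GZ_nonneg GZ_l2] by metis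

  \<comment> \<open>As \<open>X\<close> may have points arbitrarily close to each other, the discrete kernel is added: it counts the
     lamps that differ.\<close>
  define NX' where "NX' x x' = NX x x' + (if x = x' then 0 else 2)" for x x'
  have "sq_dist_kernel (mspace X) (\<lambda>x. case_sum (FX x) (\<lambda>u. if u = x then 1 else 0)) NX'"
    unfolding NX'_def using sq_dist_kernel_add[OF FX discrete_kernel] .
  note lampwise = lampwise_kernel[OF this, of x0 Y Z]
  obtain G :: "('z \<Rightarrow> 'x) \<times> 'y \<Rightarrow> (nat \<times> (('z \<Rightarrow> real) \<times> bool) list \<times> int) \<times> ('z \<Rightarrow> 'x) \<Rightarrow> real" and NL
    where lamp: "sq_dist_kernel ?W G NL"
    and NL_ge: "\<And>f y g y' z. \<lbrakk>(f, y) \<in> ?W; (g, y') \<in> ?W; z \<in> supp_diff Z f g\<rbrakk> \<Longrightarrow> D (p y) z \<le> NL (f, y) (g, y')"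
    and NL_le: "\<And>f y g y'. \<lbrakk>(f, y) \<in> ?W; (g, y') \<in> ?W\<rbrakk>
       \<Longrightarrow> NL (f, y) (g, y') \<le> D (p y) (p y') + D (p y') (p y) + 2 * (\<Sum>z\<in>supp_diff Z f g. D (p y) z)"
    using lamp_kernel[OF cut pZ, of x0 X] by metis
  have base: "sq_dist_kernel ?W (\<lambda>(f, y). FY y) (\<lambda>(f, y) (g, y'). NY y y')"
    using FY by (auto simp: sq_dist_kernel_def wreath_space_def)
  define N where "N a b = (case a of (f, y) \<Rightarrow> \<lambda>(g, y'). \<Sum>z\<in>supp_diff Z f g. NX' (f z) (g z)) b
      + NL a b + (case a of (f, y) \<Rightarrow> \<lambda>(g, y'). NY y y') b" for a b
  have N_eq: "N (f, y) (g, y') = (\<Sum>z\<in>supp_diff Z f g. NX' (f z) (g z)) + NL (f, y) (g, y') + NY y y'"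
    for f y g y' by (simp add: N_def)
  note kernel = sq_dist_kernel_add[OF sq_dist_kernel_add[OF lampwise lamp] base, folded N_def]
  have mem: "y \<in> mspace Y" "p y \<in> mspace Z" "\<And>z. z \<in> mspace Z \<Longrightarrow> f z \<in> mspace X"
    if "(f, y) \<in> ?W" for f y using that pZ by (auto simp: wreath_space_def)
  have d_eq: "?d (f, y) (g, y') = visiting_path C p Y Z (supp_diff Z f g) y y'
      + (\<Sum>z\<in>supp_diff Z f g. mdist X (f z) (g z))" if "(f, y) \<in> ?W" "(g, y') \<in> ?W" for f y g y'
    using that by (simp add: mdist_metric_wreath[OF p] wreath_dist_def)

  \<comment> \<open>A bounded distance bounds the number of lamps that differ and the size of each difference, and it
     keeps these lamps close to \<open>p y\<close>; so all three summands of \<open>N\<close> are bounded.\<close>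
  have upper: "\<exists>B. \<forall>a\<in>?W. \<forall>b\<in>?W. ?d a b \<le> R \<longrightarrow> N a b \<le> B" for R
  proof -
    define R' where "R' = max R 0"
    obtain n T where bd: "\<And>I y y'. \<lbrakk>finite I; I \<subseteq> mspace Z; y \<in> mspace Y; y' \<in> mspace Y;
        visiting_path C p Y Z I y y' \<le> R'\<rbrakk>
      \<Longrightarrow> card I \<le> n \<and> (\<forall>z\<in>I. mdist Z (p y) z \<le> T) \<and> mdist Y y y' \<le> R' + 1"
      using visited_set_bounds[OF p assms(4,6,7), of R'] by (metis R'_def max.cobounded2)
    have "R' + 1 > 0" by (simp add: R'_def)
    then obtain S where S: "\<And>y y'. \<lbrakk>y \<in> mspace Y; y' \<in> mspace Y; mdist Y y y' \<le> R' + 1\<rbrakk> \<Longrightarrow> mdist Z (p y) (p y') \<le> S"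
      using assms(4) unfolding bornologous_def by metis
    obtain BX where BX: "\<And>a b. \<lbrakk>a \<in> mspace X; b \<in> mspace X; mdist X a b \<le> R'\<rbrakk> \<Longrightarrow> NX a b \<le> BX" "BX \<ge> 0"
      using coarse_kernel_upper[OF NX, of R'] by metis
    obtain BY where BY: "\<And>a b. \<lbrakk>a \<in> mspace Y; b \<in> mspace Y; mdist Y a b \<le> R' + 1\<rbrakk> \<Longrightarrow> NY a b \<le> BY"
      using coarse_kernel_upper[OF NY, of "R' + 1"] by metis
    obtain BZ where BZ: "\<And>a b. \<lbrakk>a \<in> mspace Z; b \<in> mspace Z; mdist Z a b \<le> max S T\<rbrakk> \<Longrightarrow> MZ a b \<le> BZ" "BZ \<ge> 0"
      using coarse_kernel_upper[OF MZ, of "max S T"] by metis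
    have D_near: "D a b \<le> BZ + 1" if "a \<in> mspace Z" "b \<in> mspace Z" "mdist Z a b \<le> max S T" for a b
      using D_le[OF that(1,2)] BZ(1)[OF that] by simp
    have "N (f, y) (g, y') \<le> n * (BX + 2) + ((BZ + 1) + (BZ + 1) + 2 * (n * (BZ + 1))) + BY"
      if W: "(f, y) \<in> ?W" "(g, y') \<in> ?W" and d: "?d (f, y) (g, y') \<le> R" for f y g y'
    proof -
      let ?I = "supp_diff Z f g"
      note mem = mem[OF W(1)] mem[OF W(2)] and I = finite_supp_diff[OF W] supp_diff_subset_mspace[of Z f g]
      have path: "visiting_path C p Y Z ?I y y' \<le> R'" and sum: "(\<Sum>z\<in>?I. mdist X (f z) (g z)) \<le> R'"
        using d visiting_path_nonneg[OF p I, of y y'] sum_nonneg[of ?I "\<lambda>z. mdist X (f z) (g z)"]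
        by (auto simp: d_eq[OF W] R'_def)
      note bd = bd[OF I mem(1) mem(4) path]
      have pp: "mdist Z (p y) (p y') \<le> S" using bd by (intro S mem) auto
      have X: "NX' (f z) (g z) \<le> BX + 2" if z: "z \<in> ?I" for z
      proof -
        have zZ: "z \<in> mspace Z" using z I by auto
        have "mdist X (f z) (g z) \<le> (\<Sum>z\<in>?I. mdist X (f z) (g z))"
          using z I by (intro member_le_sum) auto
        then have "NX (f z) (g z) \<le> BX" using sum by (intro BX mem zZ) simp
        then show ?thesis using BX(2) by (cases "f z = g z") (auto simp: NX'_def)
      qed
      have "(\<Sum>z\<in>?I. NX' (f z) (g z)) \<le> card ?I * (BX + 2)" using X by (intro sum_bounded_above) auto
      also have "\<dots> \<le> n * (BX + 2)" using bd BX(2) by (intro mult_right_mono) auto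
      finally have 1: "(\<Sum>z\<in>?I. NX' (f z) (g z)) \<le> n * (BX + 2)" .
      have "(\<Sum>z\<in>?I. D (p y) z) \<le> card ?I * (BZ + 1)"
        using I bd mem by (intro sum_bounded_above D_near) (auto simp: le_max_iff_disj)
      also have "\<dots> \<le> n * (BZ + 1)" using bd BZ(2) by (intro mult_right_mono) auto
      finally have 2: "(\<Sum>z\<in>?I. D (p y) z) \<le> n * (BZ + 1)" .
      have 3: "D (p y) (p y') \<le> BZ + 1" "D (p y') (p y) \<le> BZ + 1"
        using pp by (auto intro!: D_near mem simp: le_max_iff_disj mdist_commute)
      have 4: "NY y y' \<le> BY" using bd by (intro BY mem) auto
      note NL_le[OF W]
      also have "D (p y) (p y') + D (p y') (p y) + 2 * (\<Sum>z\<in>?I. D (p y) z)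
          \<le> (BZ + 1) + (BZ + 1) + 2 * (n * (BZ + 1))"
        by (intro add_mono mult_left_mono 2 3) simp
      finally show ?thesis unfolding N_eq by (intro add_mono 1 4)
    qed
    then show ?thesis by (intro exI[of _ "n * (BX + 2) + ((BZ + 1) + (BZ + 1) + 2 * (n * (BZ + 1))) + BY"]) auto
  qed

  \<comment> \<open>Conversely, \<open>N\<close> bounds the number of lamps that differ, the size of each difference, the distance
     from \<open>p y\<close> to each such lamp, and the distance from \<open>y\<close> to \<open>y'\<close>; then the path that returns to \<open>y\<close>
     after each visit is short.\<close>
  have lower: "\<exists>R. \<forall>a\<in>?W. \<forall>b\<in>?W. N a b \<le> B \<longrightarrow> ?d a b \<le> R" for B
  proof -
    obtain RX where RX: "\<And>a b. \<lbrakk>a \<in> mspace X; b \<in> mspace X; NX a b \<le> B\<rbrakk> \<Longrightarrow> mdist X a b \<le> RX" "RX \<ge> 0"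
      using coarse_kernel_lower[OF NX, of B] by metis
    obtain RY where RY: "\<And>a b. \<lbrakk>a \<in> mspace Y; b \<in> mspace Y; NY a b \<le> B\<rbrakk> \<Longrightarrow> mdist Y a b \<le> RY"
      using coarse_kernel_lower[OF NY, of B] by metis
    obtain B' where B': "\<And>y z. \<lbrakk>y \<in> mspace Z; z \<in> mspace Z; D y z \<le> B\<rbrakk> \<Longrightarrow> MZ y z \<le> B'"
      using D_ge[of B] by blast
    obtain RZ where RZ: "\<And>a b. \<lbrakk>a \<in> mspace Z; b \<in> mspace Z; MZ a b \<le> B'\<rbrakk> \<Longrightarrow> mdist Z a b \<le> RZ" "RZ \<ge> 0"
      using coarse_kernel_lower[OF MZ, of B'] by metis
    have \<theta>RZ: "0 \<le> \<theta> RZ" using \<theta>(1) RZ(2) by auto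
    have "?d (f, y) (g, y') \<le> B * \<theta> RZ + RY + B / 2 * RX"
      if W: "(f, y) \<in> ?W" "(g, y') \<in> ?W" and le: "N (f, y) (g, y') \<le> B" for f y g y'
    proof -
      let ?I = "supp_diff Z f g"
      note mem = mem[OF W(1)] mem[OF W(2)] and I = finite_supp_diff[OF W] supp_diff_subset_mspace[of Z f g]
      have NX'_eq: "NX' (f z) (g z) = NX (f z) (g z) + 2" and NX0: "0 \<le> NX (f z) (g z)" if "z \<in> ?I" for z
        using that I mem sq_dist_kernel_nonneg[OF FX] by (auto simp: NX'_def supp_diff_def)
      have nonneg: "0 \<le> (\<Sum>z\<in>?I. NX' (f z) (g z))" "0 \<le> NL (f, y) (g, y')" "0 \<le> NY y y'"
        using sq_dist_kernel_nonneg[OF lamp W] sq_dist_kernel_nonneg[OF FY mem(1) mem(4)] NX'_eq NX0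
        by (auto intro!: sum_nonneg)
      then have parts: "(\<Sum>z\<in>?I. NX' (f z) (g z)) \<le> B" "NL (f, y) (g, y') \<le> B" "NY y y' \<le> B"
        using le unfolding N_eq by linarith+
      have "real (card ?I) * 2 \<le> (\<Sum>z\<in>?I. NX' (f z) (g z))"
        using NX'_eq NX0 by (intro sum_bounded_below) auto
      then have card: "real (card ?I) \<le> B / 2" using parts(1) by simp
      have X: "mdist X (f z) (g z) \<le> RX" if z: "z \<in> ?I" for z
      proof (rule RX)
        have "NX' (f z) (g z) \<le> (\<Sum>z\<in>?I. NX' (f z) (g z))"
          using z I NX'_eq NX0 by (intro member_le_sum) auto
        then show "NX (f z) (g z) \<le> B" using parts(1) NX'_eq[OF z] by simp
      qed (use z I mem in auto)
      have Z: "mdist Z (p y) z \<le> RZ" if z: "z \<in> ?I" for z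
      proof -
        have zZ: "z \<in> mspace Z" using z I by auto
        have "D (p y) z \<le> B" using NL_ge[OF W z] parts(2) by simp
        then show ?thesis by (intro RZ B' mem zZ)
      qed
      have "visiting_path C p Y Z ?I y y' \<le> 2 * \<theta> RZ * card ?I + mdist Y y y'"
        using Z by (intro visiting_path_star[OF lift \<theta> assms(2) pZ I mem(1) mem(4) RZ(2)]) auto
      moreover have "2 * \<theta> RZ * card ?I \<le> 2 * \<theta> RZ * (B / 2)"
        using card \<theta>RZ by (intro mult_left_mono) auto
      moreover have "mdist Y y y' \<le> RY" by (intro RY mem parts)
      moreover have "(\<Sum>z\<in>?I. mdist X (f z) (g z)) \<le> card ?I * RX" using X by (intro sum_bounded_above) auto
      moreover have "card ?I * RX \<le> B / 2 * RX" using card RX(2) by (intro mult_right_mono) auto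
      ultimately show ?thesis unfolding d_eq[OF W] by (simp add: mult.commute)
    qed
    then show ?thesis by (intro exI[of _ "B * \<theta> RZ + RY + B / 2 * RX"]) auto
  qed

  have space: "mspace (metric_wreath C p x0 X Y Z) = ?W" by (rule mspace_metric_wreath[OF p])
  have "coarse_kernel (metric_wreath C p x0 X Y Z) N"
    unfolding coarse_kernel_def space using upper lower by blast
  then show ?thesis
    using kernel unfolding space[symmetric] by (intro hilbert_coarsely_embeddable_kernelI)
qed

end
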